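(* Let $A_1,\ldots,A_r$ be positive semidefinite operators on a finite-dimensional Hilbert space, and let $p_i:=\operatorname{Tr}A_i$ and $A_0:=\sum_{i=1}^rA_i$. Then $$P_e^*(A_1,\ldots,A_r)\le P_{e,dich}^*(A_1,\ldots,A_r)\le\sum_{(i,j):\,i\ne j}F(A_i,A_j)\le\sum_{(i,j):\,i\ne j}\sqrt{p_i+p_j}\sqrt{P_e^*(A_i,A_j)}.$$ If $A_i$ is of rank one for all $i$, then $P_e^*(A_1,\ldots,A_r)\le P_{e,dich}^*(A_1,\ldots,A_r)$ and both of the following hold: $$P_{e,dich}^*(A_1,\ldots,A_r)\le(\operatorname{Tr}A_0)\sum_{(i,j):\,i\ne j}\frac1{p_ip_j}F(A_i,A_j)^2\le(\operatorname{Tr}A_0)\sum_{(i,j):\,i\ne j}\frac{p_i+p_j}{p_ip_j}P_e^*(A_i,A_j),$$ $$P_{e,dich}^*(A_1,\ldots,A_r)\le\frac{\operatorname{Tr}A_0}{\min_i\operatorname{Tr}A_i}\sum_{(i,j):\,i\ne j}P_e^*(A_i,A_j).$$ Sums over $(i,j):\,i\ne j$ run over ordered pairs.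
   Context: A POVM $\{E_1,\ldots,E_m\}$ on a finite-dimensional Hilbert space is a family of positive semidefinite operators with $E_1+\cdots+E_m\le I$. For positive semidefinite $A_1,\ldots,A_m$, the optimal error is $P_e^*(A_1,\ldots,A_m):=\min\{\sum_{i=1}^m\operatorname{Tr}A_i(I-E_i):\{E_1,\ldots,E_m\}\text{ POVM}\}$; for two operators this equals $\frac12\operatorname{Tr}(A+B)-\frac12\|A-B\|_1$ with the trace norm. With $\bar A_i:=\sum_{j\ne i}A_j$, the dichotomic error is $P_{e,dich}^*(A_1,\ldots,A_r):=\sum_{i=1}^rP_e^*(A_i,\bar A_i)$. The fidelity is $F(A,B):=\|A^{1/2}B^{1/2}\|_1$. *)

theory Defs
  imports "HOL-Analysis.Analysis"
begin

text \<open>Operators on a finite-dimensional Hilbert space are complex square matrices acting on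
  \<open>complex ^ 'n\<close> with the standard Hermitian inner product (the library's \<open>\<bullet>\<close> on
  \<open>complex ^ 'n\<close> is only its real part). Families of operators are lists, indexed from 0.\<close>

definition cinner :: "complex ^ 'n \<Rightarrow> complex ^ 'n \<Rightarrow> complex" where
  "cinner x y = (\<Sum>i\<in>UNIV. cnj (x $ i) * y $ i)"

definition adj :: "complex ^ 'n ^ 'n \<Rightarrow> complex ^ 'n ^ 'n" where
  "adj A = (\<chi> i j. cnj (A $ j $ i))"

text \<open>Over the complex numbers, a real quadratic form already makes the matrix self-adjoint.\<close>

definition psd :: "complex ^ 'n ^ 'n \<Rightarrow> bool" where
  "psd A \<longleftrightarrow> (\<forall>x. cinner x (A *v x) \<in> \<real>\<^sub>\<ge>\<^sub>0)"

definition real_trace :: "complex ^ 'n ^ 'n \<Rightarrow> real" where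
  "real_trace A = Re (trace A)"

text \<open>The positive semidefinite square root, meaningful for positive semidefinite \<open>A\<close> only.\<close>

definition psd_sqrt :: "complex ^ 'n ^ 'n \<Rightarrow> complex ^ 'n ^ 'n" where
  "psd_sqrt A = (THE B. psd B \<and> B ** B = A)"

definition trace_norm :: "complex ^ 'n ^ 'n \<Rightarrow> real" where
  "trace_norm X = real_trace (psd_sqrt (adj X ** X))"

definition fidelity :: "complex ^ 'n ^ 'n \<Rightarrow> complex ^ 'n ^ 'n \<Rightarrow> real" where
  "fidelity A B = trace_norm (psd_sqrt A ** psd_sqrt B)"

definition povm :: "(complex ^ 'n ^ 'n) list \<Rightarrow> bool" where
  "povm Es \<longleftrightarrow> (\<forall>E \<in> set Es. psd E) \<and> psd (mat 1 - sum_list Es)"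

definition povm_error :: "(complex ^ 'n ^ 'n) list \<Rightarrow> (complex ^ 'n ^ 'n) list \<Rightarrow> real" where
  "povm_error As Es = (\<Sum>i<length As. real_trace (As ! i ** (mat 1 - Es ! i)))"

text \<open>The optimal error. The infimum is a minimum, see \<open>opt_error_attained\<close> below.\<close>

definition opt_error :: "(complex ^ 'n ^ 'n) list \<Rightarrow> real" where
  "opt_error As = Inf {povm_error As Es | Es. length Es = length As \<and> povm Es}"

definition rest :: "(complex ^ 'n ^ 'n) list \<Rightarrow> nat \<Rightarrow> complex ^ 'n ^ 'n" where
  "rest As i = (\<Sum>j\<in>{..<length As} - {i}. As ! j)"

definition dich_error :: "(complex ^ 'n ^ 'n) list \<Rightarrow> real" where
  "dich_error As = (\<Sum>i<length As. opt_error [As ! i, rest As i])"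

definition off_diag :: "nat \<Rightarrow> (nat \<times> nat) set" where
  "off_diag r = {(i, j). i < r \<and> j < r \<and> i \<noteq> j}"

subsection \<open>The optimal error is attained\<close>

lemma cinner_add: "cinner (x + y) z = cinner x z + cinner y z" "cinner x (y + z) = cinner x y + cinner x z"
  by (simp_all add: cinner_def algebra_simps sum.distrib)

lemma cinner_scale: "cinner (c *s x) z = cnj c * cinner x z" "cinner x (c *s z) = c * cinner x z"
  by (simp_all add: cinner_def algebra_simps sum_distrib_left)

lemma cinner_axis: "cinner (axis i 1) (A *v axis j 1) = A $ i $ j"
  by (simp add: cinner_def matrix_vector_mult_def axis_def if_distrib if_distribR cong: if_cong)

lemma cinner_sum_matrix:
  "finite S \<Longrightarrow> cinner x ((\<Sum>i\<in>S. E i) *v x) = (\<Sum>i\<in>S. cinner x (E i *v x))"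
  by (induction S rule: finite_induct)
    (simp_all add: matrix_vector_mult_add_rdistrib cinner_add, simp add: cinner_def)

lemma psd_sum:
  assumes "finite S" "\<And>i. i \<in> S \<Longrightarrow> psd (E i)"
  shows "psd (\<Sum>i\<in>S. E i)"
proof -
  have "(\<Sum>i\<in>S. cinner x (E i *v x)) \<in> \<real>\<^sub>\<ge>\<^sub>0" for x
    using assms by (auto simp: psd_def complex_nonneg_Reals_iff intro: sum_nonneg)
  then show ?thesis
    using assms(1) by (simp add: psd_def cinner_sum_matrix)
qed

lemma cinner_polar:
  "cinner (axis i 1 + c *s axis j 1) (A *v (axis i 1 + c *s axis j 1))
   = A $ i $ i + c * A $ i $ j + cnj c * A $ j $ i + cnj c * c * A $ j $ j"
  by (simp add: matrix_vector_right_distrib cinner_add cinner_scale cinner_axis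
      vector_scalar_commute algebra_simps)

lemma psd_entry_bound:
  assumes "psd E" "psd (mat 1 - E)"
  shows "norm (E $ i $ j) \<le> 2"
proof -
  have q: "A $ i $ i + c * A $ i $ j + cnj c * A $ j $ i + cnj c * c * A $ j $ j \<in> \<real>\<^sub>\<ge>\<^sub>0"
    if "psd A" for A :: "complex ^ 'a ^ 'a" and i j c
    using that unfolding psd_def cinner_polar[symmetric] by blast
  have d: "Re (E $ k $ k) \<le> 1" "Im (E $ k $ k) = 0" for k
    using q[OF assms(2), of k 0 k] q[OF assms(1), of k 0 k]
    by (simp_all add: complex_nonneg_Reals_iff mat_def)
  have "\<bar>Re (E $ i $ j)\<bar> \<le> 1" "\<bar>Im (E $ i $ j)\<bar> \<le> 1"
    using q[OF assms(1), of i 1 j] q[OF assms(1), of i "-1" j]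
      q[OF assms(1), of i \<i> j] q[OF assms(1), of i "-\<i>" j] d[of i] d[of j]
    by (auto simp: complex_nonneg_Reals_iff)
  then show ?thesis
    using cmod_le[of "E $ i $ j"] by linarith
qed

lemma psd_norm_bound:
  fixes E :: "complex ^ 'n ^ 'n"
  assumes "psd E" "psd (mat 1 - E)"
  shows "norm E \<le> real CARD('n) * (real CARD('n) * 2)"
proof -
  have "norm (E $ i) \<le> real CARD('n) * 2" for i
  proof -
    have "norm (E $ i) \<le> (\<Sum>j\<in>UNIV. norm (E $ i $ j))"
      unfolding norm_vec_def by (rule L2_set_le_sum) simp
    also have "\<dots> \<le> (\<Sum>j\<in>(UNIV::'n set). 2)"
      by (rule sum_mono) (rule psd_entry_bound[OF assms])
    finally show ?thesis by simp
  qed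
  note b = this
  have "norm E \<le> (\<Sum>i\<in>UNIV. norm (E $ i))"
    unfolding norm_vec_def[of E] by (rule L2_set_le_sum) simp
  also have "\<dots> \<le> (\<Sum>i\<in>(UNIV::'n set). real CARD('n) * 2)"
    by (rule sum_mono) (rule b)
  finally show ?thesis by simp
qed

lemma continuous_psd_form: "continuous_on UNIV (\<lambda>A. cinner x (A *v x))"
  unfolding cinner_def matrix_vector_mult_def by (simp, intro continuous_intros)

lemma closed_psd: "closed {A :: complex ^ 'n ^ 'n. psd A}"
proof -
  have "{A :: complex ^ 'n ^ 'n. psd A} = (\<Inter>x. (\<lambda>A. cinner x (A *v x)) -` \<real>\<^sub>\<ge>\<^sub>0)"
    by (auto simp: psd_def)
  moreover have "closed ((\<lambda>A. cinner x (A *v x)) -` \<real>\<^sub>\<ge>\<^sub>0)" for x :: "complex ^ 'n"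
    using continuous_closed_vimage[OF closed_nonneg_Reals_complex] continuous_psd_form[of x]
    by (metis continuous_on_eq_continuous_at open_UNIV UNIV_I)
  ultimately show ?thesis by (simp add: closed_INT)
qed

lemma closed_psd_vimage:
  assumes "continuous_on UNIV (f :: (nat \<Rightarrow> complex ^ 'n ^ 'n) \<Rightarrow> complex ^ 'n ^ 'n)"
  shows "closed {E. psd (f E)}"
  using continuous_on_closed_vimage[of UNIV f] assms closed_psd by (auto simp: vimage_def)

lemma compact_povms:
  "compact {E :: nat \<Rightarrow> complex ^ 'n ^ 'n.
     (\<forall>i. psd (E i)) \<and> (\<forall>i. m \<le> i \<longrightarrow> E i = 0) \<and> psd (mat 1 - (\<Sum>i<m. E i))}"
  (is "compact ?S")
proof -
  let ?R = "real CARD('n) * (real CARD('n) * 2)"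
  have "compactin (product_topology (\<lambda>_::nat. euclidean) UNIV)
          (PiE UNIV (\<lambda>_. cball (0 :: complex ^ 'n ^ 'n) ?R))"
    by (simp add: compactin_PiE)
  then have K: "compact (PiE UNIV (\<lambda>_::nat. cball (0 :: complex ^ 'n ^ 'n) ?R))"
    by (simp add: euclidean_product_topology)
  have "?S = (\<Inter>i. {E. psd (E i)}) \<inter> (\<Inter>i\<in>{m..}. {E. E i = 0}) \<inter> {E. psd (mat 1 - (\<Sum>i<m. E i))}"
    by auto
  moreover have "closed \<dots>"
    by (intro closed_Int closed_INT ballI closed_psd_vimage closed_Collect_eq)
      (auto intro!: continuous_intros)
  ultimately have C: "closed ?S" by simp
  have "?S \<subseteq> PiE UNIV (\<lambda>_. cball 0 ?R)"
  proof (intro subsetI PiE_I)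
    fix E i assume E: "E \<in> ?S"
    show "E i \<in> cball 0 ?R"
    proof (cases "i < m")
      case True
      have "psd ((mat 1 - (\<Sum>j<m. E j)) + (\<Sum>j\<in>{..<m} - {i}. E j))"
        using psd_sum[of "UNIV :: bool set"
            "\<lambda>b. if b then mat 1 - (\<Sum>j<m. E j) else (\<Sum>j\<in>{..<m} - {i}. E j)"]
          psd_sum[of "{..<m} - {i}" E] E by (simp add: UNIV_bool add.commute)
      moreover have "(mat 1 - (\<Sum>j<m. E j)) + (\<Sum>j\<in>{..<m} - {i}. E j) = mat 1 - E i"
        using True by (simp add: sum.remove[of "{..<m}" i])
      ultimately show ?thesis
        using psd_norm_bound[of "E i"] E by simp
    next
      case False
      then show ?thesis using E by simp
    qed
  qed simp
  then show ?thesis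
    using compact_Int_closed[OF K C] by (simp add: Int_absorb1)
qed

lemma opt_error_attained:
  fixes As :: "(complex ^ 'n ^ 'n) list"
  obtains Es where "length Es = length As" "povm Es" "povm_error As Es = opt_error As"
    "\<And>Fs. length Fs = length As \<Longrightarrow> povm Fs \<Longrightarrow> povm_error As Es \<le> povm_error As Fs"
proof -
  let ?m = "length As"
  let ?S = "{E :: nat \<Rightarrow> complex ^ 'n ^ 'n.
     (\<forall>i. psd (E i)) \<and> (\<forall>i. ?m \<le> i \<longrightarrow> E i = 0) \<and> psd (mat 1 - (\<Sum>i<?m. E i))}"
  let ?f = "\<lambda>E. \<Sum>i<?m. real_trace (As ! i ** (mat 1 - E i))"
  have psd0: "psd (0 :: complex ^ 'n ^ 'n)"
    by (simp add: psd_def cinner_def)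
  have "(\<Sum>i\<in>UNIV. cnj (x $ i) * x $ i) \<in> \<real>\<^sub>\<ge>\<^sub>0" for x :: "complex ^ 'n"
    by (auto simp: complex_nonneg_Reals_iff intro!: sum_nonneg)
  then have "psd (mat 1 :: complex ^ 'n ^ 'n)"
    by (simp add: psd_def cinner_def)
  then have "(\<lambda>_. 0) \<in> ?S" using psd0 by simp
  then have ne: "?S \<noteq> {}" by (metis (no_types, lifting) empty_iff)
  have "continuous_on ?S ?f"
    unfolding real_trace_def trace_def matrix_matrix_mult_def
    by (simp, intro continuous_intros continuous_on_subset[OF continuous_on_product_coordinates]) auto
  then obtain E where E: "E \<in> ?S" and min: "\<And>F. F \<in> ?S \<Longrightarrow> ?f E \<le> ?f F"
    using continuous_attains_inf[OF compact_povms ne, of ?f] by blast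
  define Es where "Es = map E [0..<?m]"
  have len: "length Es = ?m" by (simp add: Es_def)
  have povm: "povm Es"
    using E by (auto simp: povm_def Es_def interv_sum_list_conv_sum_set_nat atLeast0LessThan)
  have le: "povm_error As Es \<le> povm_error As Fs" if "length Fs = ?m" "povm Fs" for Fs
  proof -
    have "(\<lambda>i. if i < ?m then Fs ! i else 0) \<in> ?S"
      using that psd0 by (auto simp: povm_def sum_list_sum_nth atLeast0LessThan)
    from min[OF this] show ?thesis
      by (simp add: povm_error_def Es_def)
  qed
  have "opt_error As = povm_error As Es"
    unfolding opt_error_def
    by (rule cInf_eq_minimum) (use len povm le in auto)
  with len povm le show thesis
    using that by simp
qed

end

theory Submission
  imports Defs
begin

text \<open>The bound by the dichotomic error uses the pretty good measurement \<open>M\<^sub>i = T A\<^sub>i T\<close>, where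
  \<open>S = \<Sum> A\<^sub>i\<close>, \<open>R = \<surd>S\<close> and \<open>T\<close> is the pseudo-inverse of \<open>R\<close>: for \<open>0 \<le> E \<le> I\<close>, the operator
  \<open>H = A\<^sub>i - R E R\<close> satisfies \<open>Tr H T H T \<ge> 0\<close>, which expands to
  \<open>Tr A\<^sub>i M\<^sub>i \<ge> Tr E (2 A\<^sub>i - S)\<close>. The dichotomic error is bounded by fidelities through
  \<open>P\<^sub>e(A, B) \<le> Tr \<surd>A \<surd>B \<le> F(A, B)\<close> and the subadditivity of \<open>Tr \<surd>P\<close>, and the fidelity by
  the error through the Cauchy-Schwarz inequality, applied after inserting an optimal test \<open>E\<close> and \<open>I - E\<close>
  between the two square roots. If \<open>A\<^sub>i\<close> has rank one, the projection \<open>A\<^sub>i / p\<^sub>i\<close> is a test of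
  \<open>A\<^sub>i\<close> against the rest with error \<open>\<Sum> Tr A\<^sub>j A\<^sub>i / p\<^sub>i\<close> (over \<open>j \<noteq> i\<close>), and
  \<open>Tr A B \<le> F(A, B)\<^sup>2\<close>.\<close>

subsection \<open>Matrix algebra\<close>

lemma matrix_diff_ldistrib: "A ** (B - C) = A ** B - A ** C" for A :: "'a::ring_1 ^ 'n ^ 'm"
  by (simp add: vec_eq_iff matrix_matrix_mult_def sum_subtractf right_diff_distrib)

lemma matrix_diff_rdistrib: "(A - B) ** C = A ** C - B ** C" for A :: "'a::ring_1 ^ 'n ^ 'm"
  by (simp add: vec_eq_iff matrix_matrix_mult_def sum_subtractf left_diff_distrib)

lemma matrix_add_rdistrib: "(A + B) ** C = A ** C + B ** C" for A :: "'a::semiring_1 ^ 'n ^ 'm"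
  by (simp add: vec_eq_iff matrix_matrix_mult_def sum.distrib distrib_right)

lemma matrix_zero_mult [simp]: "0 ** A = 0" "A ** 0 = 0"
  by (simp_all add: vec_eq_iff matrix_matrix_mult_def)

lemma matrix_sum_mult:
  "(\<Sum>i\<in>S. E i) ** B = (\<Sum>i\<in>S. E i ** B)" "B ** (\<Sum>i\<in>S. E i) = (\<Sum>i\<in>S. B ** E i)"
  for B :: "'a::ring_1 ^ 'n ^ 'n"
  by (induction S rule: infinite_finite_induct)
    (simp_all add: matrix_add_ldistrib matrix_add_rdistrib)

lemmas matrix_ring_simps =
  matrix_add_ldistrib matrix_add_rdistrib matrix_diff_ldistrib matrix_diff_rdistrib matrix_mul_assoc

section \<open>Adjoints and the Hermitian form\<close>

lemma adj_mult: "adj (A ** B) = adj B ** adj A"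
  by (simp add: adj_def vec_eq_iff matrix_matrix_mult_def mult.commute)

lemma adj_adj [simp]: "adj (adj A) = A"
  by (simp add: adj_def vec_eq_iff)

lemma adj_add: "adj (A + B) = adj A + adj B"
  by (simp add: adj_def vec_eq_iff)

lemma adj_diff: "adj (A - B) = adj A - adj B"
  by (simp add: adj_def vec_eq_iff)

lemma adj_one [simp]: "adj (mat 1) = mat 1"
  by (simp add: adj_def vec_eq_iff mat_def)

lemma cinner_zero [simp]: "cinner 0 x = 0" "cinner x 0 = 0"
  by (simp_all add: cinner_def)

lemma cinner_adj: "cinner x (adj A *v y) = cinner (A *v x) y"
proof -
  have "cinner x (adj A *v y) = (\<Sum>i\<in>UNIV. \<Sum>j\<in>UNIV. cnj (x $ i) * cnj (A $ j $ i) * y $ j)"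
    by (simp add: cinner_def adj_def matrix_vector_mult_def sum_distrib_left mult.assoc)
  also have "\<dots> = (\<Sum>j\<in>UNIV. \<Sum>i\<in>UNIV. cnj (x $ i) * cnj (A $ j $ i) * y $ j)"
    by (rule sum.swap)
  also have "\<dots> = (\<Sum>j\<in>UNIV. (\<Sum>i\<in>UNIV. cnj (A $ j $ i) * cnj (x $ i)) * y $ j)"
    by (simp add: sum_distrib_left mult.commute)
  also have "\<dots> = cinner (A *v x) y"
    by (simp add: cinner_def matrix_vector_mult_def)
  finally show ?thesis .
qed

lemma cinner_commute: "cinner y x = cnj (cinner x y)"
  by (simp add: cinner_def mult.commute)

lemma cinner_diff: "cinner (x - y) z = cinner x z - cinner y z" "cinner x (y - z) = cinner x y - cinner x z"
  by (simp_all add: cinner_def algebra_simps sum_subtractf)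

lemma cinner_sum_right: "cinner y (\<Sum>i\<in>S. f i) = (\<Sum>i\<in>S. cinner y (f i))"
  by (induction S rule: infinite_finite_induct) (simp_all add: cinner_add)

lemma Re_cinner: "Re (cinner x y) = x \<bullet> y"
  by (simp add: cinner_def inner_vec_def inner_complex_def)

lemma cinner_self: "cinner x x = of_real ((norm x)\<^sup>2)"
proof -
  have "Im (cinner x x) = 0"
    by (simp add: cinner_def)
  then show ?thesis
    by (simp add: complex_eq_iff Re_cinner dot_square_norm)
qed

lemma scaleR_eq_scale: "c *\<^sub>R x = complex_of_real c *s x"
  unfolding vec_eq_iff by (simp add: scaleR_conv_of_real[of c "_ $ _"])

lemma matrix_vector_scaleR: "A *v (c *\<^sub>R x) = c *\<^sub>R (A *v x)" for A :: "complex ^ 'n ^ 'm"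
  by (rule linear_scale) (rule matrix_vector_mul_linear)

text \<open>Polarisation: reality of the form at \<open>axis i 1 + c *s axis j 1\<close> for
  \<open>c = 1\<close> and \<open>c = \<i>\<close>, together with real diagonal entries, ties the
  imaginary and the real part of \<open>A $ j $ i\<close> to those of
  \<open>A $ i $ j\<close>.\<close>

lemma psd_selfadjoint:
  assumes "psd A"
  shows "adj A = A"
proof -
  have q: "A $ i $ i + c * A $ i $ j + cnj c * A $ j $ i + cnj c * c * A $ j $ j \<in> \<real>\<^sub>\<ge>\<^sub>0" for i j c
    using assms unfolding psd_def cinner_polar[symmetric] by blast
  have "cnj (A $ j $ i) = A $ i $ j" for i j
    using q[of i 1 j] q[of i \<i> j] q[of i 0 i] q[of j 0 j]
    by (simp add: complex_nonneg_Reals_iff complex_eq_iff)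
  then show ?thesis
    by (simp add: adj_def vec_eq_iff)
qed

text \<open>For self-adjoint \<open>A\<close> the Hermitian form is real, so positivity can be
  tested with the real inner product \<open>\<bullet>\<close>.\<close>

lemma psd_iff: "psd A \<longleftrightarrow> adj A = A \<and> (\<forall>x. x \<bullet> (A *v x) \<ge> 0)"
proof
  assume "psd A"
  then show "adj A = A \<and> (\<forall>x. x \<bullet> (A *v x) \<ge> 0)"
    using psd_selfadjoint by (auto simp: psd_def complex_nonneg_Reals_iff Re_cinner)
next
  assume r: "adj A = A \<and> (\<forall>x. x \<bullet> (A *v x) \<ge> 0)"
  have "Im (cinner x (A *v x)) = 0" for x
    using cinner_adj[of x A x] cinner_commute[of "A *v x" x] r by (simp add: complex_eq_iff)
  with r show "psd A"
    by (simp add: psd_def complex_nonneg_Reals_iff Re_cinner)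
qed

lemma psd_add: "psd A \<Longrightarrow> psd B \<Longrightarrow> psd (A + B)"
  by (simp add: psd_iff adj_add matrix_vector_mult_add_rdistrib inner_add_right)

lemma psd_zero: "psd 0"
  by (simp add: psd_def)

lemma psd_congruence:
  assumes "psd A"
  shows "psd (adj X ** A ** X)"
  using assms by (simp add: psd_def matrix_vector_mul_assoc[symmetric] cinner_adj)

lemma psd_congruence':
  assumes "psd A"
  shows "psd (X ** A ** adj X)"
  using psd_congruence[OF assms, of "adj X"] by simp

lemma psd_one: "psd (mat 1)"
  by (simp add: psd_def cinner_self)

lemma psd_adj_mult: "psd (adj X ** X)"
  using psd_congruence[OF psd_one, of X] by simp

lemma psd_square: "adj X = X \<Longrightarrow> psd (X ** X)"
  using psd_adj_mult[of X] by simp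

lemma psd_diag: "psd A \<Longrightarrow> Re (A $ i $ i) \<ge> 0"
  using cinner_axis[of i A i] unfolding psd_def by (metis complex_nonneg_Reals_iff)

section \<open>Trace and Hilbert-Schmidt inner product\<close>

lemma real_trace_add: "real_trace (A + B) = real_trace A + real_trace B"
  by (simp add: real_trace_def trace_add)

lemma real_trace_diff: "real_trace (A - B) = real_trace A - real_trace B"
  by (simp add: real_trace_def trace_sub)

lemma real_trace_zero [simp]: "real_trace 0 = 0"
  by (simp add: real_trace_def trace_def)

lemma real_trace_sum: "real_trace (\<Sum>i\<in>S. E i) = (\<Sum>i\<in>S. real_trace (E i))"
  by (induction S rule: infinite_finite_induct) (simp_all add: real_trace_add)

lemma real_trace_scaleR: "real_trace (c *\<^sub>R A) = c * real_trace A"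
  by (simp add: real_trace_def trace_def sum_distrib_left)

lemma real_trace_commute: "real_trace (A ** B) = real_trace (B ** A)"
  unfolding real_trace_def by (subst trace_mul_sym) simp

lemma real_trace_adj: "real_trace (adj A) = real_trace A"
  by (simp add: real_trace_def trace_def adj_def)

lemma real_trace_nonneg: "psd A \<Longrightarrow> real_trace A \<ge> 0"
  by (auto simp: real_trace_def trace_def intro!: sum_nonneg psd_diag)

text \<open>The real Hilbert-Schmidt inner product is the library's \<open>\<bullet>\<close> on
  nested vectors; hence \<open>norm\<close> of a matrix is the Frobenius norm, and Cauchy-Schwarz
  becomes available.\<close>

lemma real_trace_adj_mult: "real_trace (adj A ** B) = A \<bullet> B"
proof -
  have "real_trace (adj A ** B) = (\<Sum>i\<in>UNIV. \<Sum>j\<in>UNIV. (A $ j $ i) \<bullet> (B $ j $ i))"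
    by (simp add: real_trace_def trace_def adj_def matrix_matrix_mult_def inner_complex_def)
  also have "\<dots> = (\<Sum>j\<in>UNIV. \<Sum>i\<in>UNIV. (A $ j $ i) \<bullet> (B $ j $ i))"
    by (rule sum.swap)
  finally show ?thesis
    by (simp add: inner_vec_def)
qed

lemma real_trace_adj_mult_self: "real_trace (adj A ** A) = (norm A)\<^sup>2"
  by (simp add: real_trace_adj_mult dot_square_norm)

lemma norm_adj: "norm (adj A) = norm A"
  using real_trace_adj_mult_self[of A] real_trace_adj_mult_self[of "adj A"]
    real_trace_commute[of A "adj A"] by simp

lemma real_trace_mult_le: "real_trace (A ** B) \<le> norm A * norm B" for A :: "complex ^ 'n ^ 'n"
  using real_trace_adj_mult[of "adj A" B] norm_cauchy_schwarz[of "adj A" B] by (simp add: norm_adj)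

subsection \<open>Spectral theorem\<close>

text \<open>The vector \<open>x\<close> maximises the Rayleigh quotient on the unit sphere of the
  orthogonal complement of \<open>S\<close>. As \<open>S\<close> consists of eigenvectors,
  \<open>A\<close> preserves that complement, so the residual \<open>w\<close> of the eigenvalue
  equation lies in it, and perturbing \<open>x\<close> along \<open>w\<close> shows
  \<open>w = 0\<close>.\<close>

lemma selfadjoint_eigenvector_in_complement:
  fixes A :: "complex ^ 'n ^ 'n"
  assumes A: "adj A = A"
    and inv: "\<And>s. s \<in> S \<Longrightarrow> \<exists>c. A *v s = complex_of_real c *s s"
    and v: "v \<noteq> 0" "\<And>s. s \<in> S \<Longrightarrow> cinner s v = 0"
  obtains x c where "norm x = 1" "\<And>s. s \<in> S \<Longrightarrow> cinner s x = 0" "A *v x = complex_of_real c *s x"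
proof -
  let ?V = "{x. \<forall>s\<in>S. cinner s x = 0}"
  let ?K = "sphere 0 1 \<inter> ?V"
  have sa: "(A *v x) \<bullet> y = x \<bullet> (A *v y)" for x y
    using cinner_adj[of x A y] A by (simp flip: Re_cinner)
  have "closed (\<Inter>s\<in>S. {x. cinner s x = 0})"
    unfolding cinner_def by (intro closed_INT ballI closed_Collect_eq continuous_intros)
  moreover have "(\<Inter>s\<in>S. {x. cinner s x = 0}) = ?V" by auto
  ultimately have cpt: "compact ?K"
    by (intro compact_Int_closed) auto
  have "(1 / norm v) *\<^sub>R v \<in> ?K"
  proof -
    have "cinner s ((1 / norm v) *\<^sub>R v) = 0" if "s \<in> S" for s
      using v(2)[OF that] by (simp add: scaleR_eq_scale cinner_scale)
    then show ?thesis using v(1) by simp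
  qed
  then have ne: "?K \<noteq> {}" by blast
  have "continuous_on ?K (\<lambda>x. x \<bullet> (A *v x))"
    by (intro continuous_intros linear_continuous_on matrix_vector_mul_bounded_linear)
  then obtain x where x: "x \<in> ?K" and max: "\<And>y. y \<in> ?K \<Longrightarrow> y \<bullet> (A *v y) \<le> x \<bullet> (A *v x)"
    using continuous_attains_sup[OF cpt ne] by blast
  define c where "c = x \<bullet> (A *v x)"
  define w where "w = c *\<^sub>R x - A *v x"
  have scale_V: "a *\<^sub>R y \<in> ?V" if "y \<in> ?V" for a y
    using that by (auto simp: scaleR_eq_scale cinner_scale)
  have form: "y \<bullet> (A *v y) \<le> c * (norm y)\<^sup>2" if "y \<in> ?V" for y
  proof (cases "y = 0")
    case False
    then have "(1 / norm y) *\<^sub>R y \<in> ?K"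
      using scale_V[OF that, of "1 / norm y"] by simp
    from max[OF this] show ?thesis
      using False by (simp add: matrix_vector_scaleR c_def field_simps power2_eq_square)
  qed simp
  have AV: "A *v x \<in> ?V"
  proof safe
    fix s assume s: "s \<in> S"
    then obtain a where "A *v s = complex_of_real a *s s" using inv by blast
    then show "cinner s (A *v x) = 0"
      using cinner_adj[of s A x] A x s by (simp add: cinner_scale)
  qed
  have w: "w \<in> ?V"
    using AV scale_V[of x c] x by (auto simp: w_def cinner_diff)
  define K where "K = c * (norm w)\<^sup>2 - w \<bullet> (A *v w)"
  have K0: "K \<ge> 0" using form[OF w] by (simp add: K_def)
  \<comment> \<open>First-order test: in the form bound at \<open>x - t *\<^sub>R w\<close> the
    constant terms cancel, the linear term is \<open>- 2 * t\<close> times the squared norm of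
    \<open>w\<close>, and \<open>K\<close> collects the quadratic terms.\<close>
  have key: "2 * t * (norm w)\<^sup>2 \<le> t\<^sup>2 * K" for t
  proof -
    have "x - t *\<^sub>R w \<in> ?V"
      using scale_V[OF w, of t] x by (auto simp: cinner_diff)
    from form[OF this]
    have f: "(x - t *\<^sub>R w) \<bullet> (A *v (x - t *\<^sub>R w)) \<le> c * ((x - t *\<^sub>R w) \<bullet> (x - t *\<^sub>R w))"
      by (simp add: dot_square_norm)
    have f1: "(x - t *\<^sub>R w) \<bullet> (A *v (x - t *\<^sub>R w))
        = c - 2 * t * (w \<bullet> (A *v x)) + t\<^sup>2 * (w \<bullet> (A *v w))"
      using sa[of x w]
      by (simp add: matrix_vector_mult_diff_distrib matrix_vector_scaleR inner_diff_left
          inner_diff_right c_def power2_eq_square inner_commute algebra_simps)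
    have f2: "(x - t *\<^sub>R w) \<bullet> (x - t *\<^sub>R w) = 1 - 2 * t * (w \<bullet> x) + t\<^sup>2 * (norm w)\<^sup>2"
    proof -
      have "x \<bullet> x = 1" using x by (simp add: dot_square_norm)
      then show ?thesis
        unfolding dot_square_norm[of w, symmetric]
        by (simp add: inner_diff_left inner_diff_right power2_eq_square inner_commute algebra_simps)
    qed
    have "0 \<le> - 2 * t * (c * (w \<bullet> x) - w \<bullet> (A *v x)) + t\<^sup>2 * K"
      using f unfolding f1 f2 K_def by (simp add: algebra_simps)
    moreover have "c * (w \<bullet> x) - w \<bullet> (A *v x) = (norm w)\<^sup>2"
      by (simp add: w_def inner_diff_right flip: dot_square_norm)
    ultimately show ?thesis by simp
  qed
  have "w = 0"
  proof (rule ccontr)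
    assume "w \<noteq> 0"
    then have n: "(norm w)\<^sup>2 > 0" by simp
    \<comment> \<open>Small enough that \<open>t * K\<close> is at most the squared norm of
      \<open>w\<close>; the \<open>+ 1\<close> covers \<open>K = 0\<close>.\<close>
    define t where "t = (norm w)\<^sup>2 / (K + 1)"
    have t: "t > 0" using n K0 by (simp add: t_def)
    have "2 * (norm w)\<^sup>2 \<le> t * K"
      using key[of t] t by (simp add: power2_eq_square)
    also have "\<dots> \<le> (norm w)\<^sup>2"
      using K0 n by (simp add: t_def field_simps)
    finally show False using n by simp
  qed
  then have "A *v x = complex_of_real c *s x"
    by (simp add: w_def scaleR_eq_scale)
  then show thesis
    using that[of x c] x by auto
qed

text \<open>Induction on \<open>k\<close>: fewer than \<open>CARD('n)\<close> vectors do not span,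
  so the Gram-Schmidt remainder \<open>w\<close> of a vector outside the span shows that the
  complement is nonzero, and it contains the next eigenvector.\<close>

lemma selfadjoint_orthonormal_eigenvectors:
  fixes A :: "complex ^ 'n ^ 'n"
  assumes A: "adj A = A" and "k \<le> CARD('n)"
  shows "\<exists>S. finite S \<and> card S = k
    \<and> (\<forall>s\<in>S. \<forall>t\<in>S. cinner s t = (if s = t then 1 else 0))
    \<and> (\<forall>s\<in>S. \<exists>c. A *v s = complex_of_real c *s s)"
  using assms(2)
proof (induction k)
  case 0
  show ?case by (intro exI[of _ "{}"]) simp
next
  case (Suc k)
  then obtain S where S: "finite S" "card S = k"
    "\<And>s t. s \<in> S \<Longrightarrow> t \<in> S \<Longrightarrow> cinner s t = (if s = t then 1 else 0)"
    "\<And>s. s \<in> S \<Longrightarrow> \<exists>c. A *v s = complex_of_real c *s s"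
    by auto
  have "vec.span S \<noteq> UNIV"
  proof
    assume "vec.span S = UNIV"
    then have "vec.dim (UNIV :: (complex ^ 'n) set) \<le> card S"
      using S(1) by (intro vec.dim_le_card) auto
    then show False
      using Suc.prems S(2) by (simp add: vec.dim_UNIV card_cart_basis)
  qed
  then obtain v where v: "v \<notin> vec.span S" by blast
  define w where "w = v - (\<Sum>s\<in>S. cinner s v *s s)"
  have "w \<noteq> 0"
  proof
    assume "w = 0"
    then have "v = (\<Sum>s\<in>S. cinner s v *s s)" by (simp add: w_def)
    then have "v \<in> vec.span S"
      by (metis (no_types, lifting) vec.span_sum vec.span_scale vec.span_base)
    with v show False by blast
  qed
  moreover have "cinner s w = 0" if s: "s \<in> S" for s
  proof -
    have "(\<Sum>t\<in>S. cinner t v * cinner s t) = (\<Sum>t\<in>S. if s = t then cinner t v else 0)"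
      using S(3) s by (intro sum.cong) auto
    then show ?thesis
      using S(1) s by (simp add: w_def cinner_diff cinner_sum_right cinner_scale)
  qed
  ultimately obtain x c where x: "norm x = 1" "\<And>s. s \<in> S \<Longrightarrow> cinner s x = 0"
    "A *v x = complex_of_real c *s x"
    using selfadjoint_eigenvector_in_complement[OF A, of S w] S(4) by blast
  have xx: "cinner x x = 1"
    using x(1) by (simp add: cinner_self)
  then have "x \<notin> S" using x(2) by force
  moreover have "cinner x s = 0" if "s \<in> S" for s
    using x(2)[OF that] cinner_commute[of x s] by simp
  ultimately show ?case
    using S x xx by (intro exI[of _ "insert x S"]) auto
qed

section \<open>Functional calculus in an eigenbasis\<close>

definition diag_mat :: "('n \<Rightarrow> real) \<Rightarrow> complex ^ 'n ^ 'n" where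
  "diag_mat f = (\<chi> i j. if i = j then complex_of_real (f i) else 0)"

text \<open>For unitary \<open>V\<close> and \<open>A = spectral V d\<close>, the matrix
  \<open>spectral V (\<lambda>i. g (d i))\<close> is the function \<open>g\<close> applied to
  \<open>A\<close>. Unitarity is left to the lemmas that use it.\<close>

definition spectral :: "complex ^ 'n ^ 'n \<Rightarrow> ('n \<Rightarrow> real) \<Rightarrow> complex ^ 'n ^ 'n" where
  "spectral V f = V ** diag_mat f ** adj V"

theorem spectral_theorem:
  fixes A :: "complex ^ 'n ^ 'n"
  assumes A: "adj A = A"
  obtains V d where "adj V ** V = mat 1" "V ** adj V = mat 1" "A = spectral V d"
proof -
  obtain S where S: "finite S" "card S = CARD('n)"
    "\<And>s t. s \<in> S \<Longrightarrow> t \<in> S \<Longrightarrow> cinner s t = (if s = t then 1 else 0)"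
    "\<And>s. s \<in> S \<Longrightarrow> \<exists>c. A *v s = complex_of_real c *s s"
    using selfadjoint_orthonormal_eigenvectors[OF A, of "CARD('n)"] by auto
  obtain e where e: "bij_betw e (UNIV :: 'n set) S"
    using S(1,2) finite_same_card_bij[of "UNIV :: 'n set" S] by auto
  have "\<forall>k. \<exists>c. A *v e k = complex_of_real c *s e k"
    using S(4) e by (auto simp: bij_betw_def)
  then obtain d where d: "\<And>k. A *v e k = complex_of_real (d k) *s e k"
    by metis
  define V where "V = (\<chi> i k. e k $ i)"
  have "(adj V ** V) $ i $ j = cinner (e i) (e j)" for i j
    by (simp add: V_def adj_def matrix_matrix_mult_def cinner_def)
  moreover have "cinner (e i) (e j) = (if i = j then 1 else 0)" for i j
    using S(3)[of "e i" "e j"] e by (auto simp: bij_betw_def inj_on_def)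
  ultimately have V: "adj V ** V = mat 1"
    by (simp add: vec_eq_iff mat_def)
  then have V': "V ** adj V = mat 1"
    by (simp add: matrix_left_right_inverse)
  have "(A ** V) $ i $ k = (A *v e k) $ i" for i k
    by (simp add: V_def matrix_matrix_mult_def matrix_vector_mult_def)
  moreover have "(V ** diag_mat d) $ i $ k = complex_of_real (d k) * e k $ i" for i k
    by (simp add: V_def diag_mat_def matrix_matrix_mult_def if_distrib mult.commute cong: if_cong)
  ultimately have "A ** V = V ** diag_mat d"
    by (simp add: vec_eq_iff d)
  then have "A ** (V ** adj V) = spectral V d"
    by (simp add: spectral_def matrix_mul_assoc)
  then show thesis
    using that V V' by simp
qed

lemma diag_mat_mult: "diag_mat f ** diag_mat g = diag_mat (\<lambda>i. f i * g i)" for f g :: "'n::finite \<Rightarrow> real"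
proof -
  have "(A ** diag_mat g) $ i $ j = A $ i $ j * complex_of_real (g j)" for A :: "complex ^ 'n ^ 'n" and i j
    by (simp add: diag_mat_def matrix_matrix_mult_def if_distrib cong: if_cong)
  then show ?thesis
    by (simp add: vec_eq_iff) (simp add: diag_mat_def)
qed

lemma psd_diag_mat:
  assumes "\<And>i. f i \<ge> 0"
  shows "psd (diag_mat f)"
proof -
  have "cinner x (diag_mat f *v x) = complex_of_real (\<Sum>i\<in>UNIV. f i * (cmod (x $ i))\<^sup>2)" for x
  proof -
    have "cnj z * (complex_of_real c * z) = complex_of_real (c * (cmod z)\<^sup>2)" for z c
      using complex_norm_square[of z] by (simp add: mult.commute mult.left_commute)
    then have "cinner x (diag_mat f *v x) = (\<Sum>i\<in>UNIV. complex_of_real (f i * (cmod (x $ i))\<^sup>2))"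
      by (simp add: cinner_def diag_mat_def matrix_vector_mult_def if_distrib if_distribR
          del: of_real_mult of_real_power cong: if_cong)
    then show ?thesis by simp
  qed
  then show ?thesis
    using assms by (simp add: psd_def complex_nonneg_Reals_iff sum_nonneg)
qed

lemma spectral_mult:
  assumes "adj V ** V = mat 1"
  shows "spectral V f ** spectral V g = spectral V (\<lambda>i. f i * g i)"
proof -
  have "spectral V f ** spectral V g = V ** diag_mat f ** (adj V ** V) ** diag_mat g ** adj V"
    by (simp only: spectral_def matrix_mul_assoc)
  also have "\<dots> = V ** (diag_mat f ** diag_mat g) ** adj V"
    by (simp only: assms matrix_mul_rid matrix_mul_assoc)
  finally show ?thesis
    by (simp only: diag_mat_mult spectral_def)
qed

lemma spectral_diff: "spectral V f - spectral V g = spectral V (\<lambda>i. f i - g i)"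
proof -
  have "diag_mat f - diag_mat g = diag_mat (\<lambda>i. f i - g i)"
    by (simp add: diag_mat_def vec_eq_iff)
  then show ?thesis
    by (simp add: spectral_def flip: matrix_diff_ldistrib matrix_diff_rdistrib)
qed

lemma spectral_one:
  fixes V :: "complex ^ 'n ^ 'n"
  assumes "V ** adj V = mat 1"
  shows "spectral V (\<lambda>_. 1) = mat 1"
proof -
  have "diag_mat (\<lambda>_. 1) = (mat 1 :: complex ^ 'n ^ 'n)"
    by (simp add: diag_mat_def vec_eq_iff mat_def)
  then show ?thesis using assms by (simp add: spectral_def)
qed

lemma psd_spectral: "(\<And>i. f i \<ge> 0) \<Longrightarrow> psd (spectral V f)"
  unfolding spectral_def by (intro psd_congruence' psd_diag_mat)

lemma conj_spectral:
  assumes "adj V ** V = mat 1"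
  shows "adj V ** spectral V d ** V = diag_mat d"
proof -
  have "adj V ** spectral V d ** V = (adj V ** V) ** diag_mat d ** (adj V ** V)"
    by (simp only: spectral_def matrix_mul_assoc)
  then show ?thesis by (simp add: assms)
qed

lemma psd_spectral_nonneg:
  assumes "adj V ** V = mat 1" "psd (spectral V d)"
  shows "d i \<ge> 0"
  using psd_diag[OF psd_congruence[OF assms(2), of V], of i]
  unfolding conj_spectral[OF assms(1)] by (simp add: diag_mat_def)

lemma psd_spectral_theorem:
  fixes A :: "complex ^ 'n ^ 'n"
  assumes "psd A"
  obtains V d where "adj V ** V = mat 1" "V ** adj V = mat 1" "A = spectral V d" "\<And>i. d i \<ge> 0"
proof -
  obtain V d where V: "adj V ** V = mat 1" "V ** adj V = mat 1" "A = spectral V d"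
    using spectral_theorem[OF psd_selfadjoint[OF assms]] by blast
  then show thesis
    using that[OF V] psd_spectral_nonneg[OF V(1), of d] assms by simp
qed

lemma real_trace_spectral:
  assumes "adj V ** V = mat 1"
  shows "real_trace (spectral V f) = (\<Sum>i\<in>UNIV. f i)"
proof -
  have "real_trace (spectral V f) = real_trace (adj V ** (V ** diag_mat f))"
    unfolding spectral_def by (rule real_trace_commute)
  also have "\<dots> = real_trace (diag_mat f)"
    by (simp add: matrix_mul_assoc assms)
  finally show ?thesis
    by (simp add: real_trace_def trace_def diag_mat_def)
qed

subsection \<open>Positive semidefinite square roots\<close>

lemma ex_psd_sqrt:
  assumes "psd A"
  shows "\<exists>R. psd R \<and> R ** R = A"
proof -
  obtain V d where V: "adj V ** V = mat 1" "V ** adj V = mat 1" "A = spectral V d" "\<And>i. d i \<ge> 0"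
    by (rule psd_spectral_theorem[OF assms]) blast
  then have "psd (spectral V (\<lambda>i. sqrt (d i))) \<and> spectral V (\<lambda>i. sqrt (d i)) ** spectral V (\<lambda>i. sqrt (d i)) = A"
    by (simp add: psd_spectral spectral_mult[OF V(1)])
  then show ?thesis by blast
qed

text \<open>With \<open>R\<close> a square root of \<open>P\<close>, cyclicity turns the trace into
  that of the positive semidefinite matrix \<open>R ** Q ** R\<close>.\<close>

lemma real_trace_mult_nonneg:
  assumes "psd P" "psd Q"
  shows "real_trace (P ** Q) \<ge> 0"
proof -
  obtain R where R: "psd R" "R ** R = P" using ex_psd_sqrt[OF assms(1)] by blast
  have "real_trace (P ** Q) = real_trace (R ** (R ** Q))"
    using R(2) by (simp add: matrix_mul_assoc)
  also have "\<dots> = real_trace (R ** Q ** adj R)"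
    using psd_selfadjoint[OF R(1)] by (subst real_trace_commute) simp
  finally show ?thesis
    using real_trace_nonneg[OF psd_congruence'[OF assms(2), of R]] by simp
qed

lemma adj_mult_self_eq_0_iff: "adj X ** X = 0 \<longleftrightarrow> X = 0"
  using real_trace_adj_mult_self[of X] by auto

lemma psd_trace_eq_0:
  assumes "psd P" "real_trace P = 0"
  shows "P = 0"
proof -
  obtain R where R: "psd R" "R ** R = P" using ex_psd_sqrt[OF assms(1)] by blast
  then have "(norm R)\<^sup>2 = 0"
    using assms(2) real_trace_adj_mult_self[of R] psd_selfadjoint[OF R(1)] by simp
  with R(2) show ?thesis by simp
qed

text \<open>For \<open>A = R ** R\<close> with \<open>R\<close> self-adjoint, the hypothesis says
  that \<open>R ** X\<close> has Frobenius norm 0.\<close>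

lemma conj_eq_0_imp_mult_eq_0:
  assumes "psd A" "adj X ** A ** X = 0"
  shows "A ** X = 0"
proof -
  obtain R where R: "psd R" "R ** R = A" using ex_psd_sqrt[OF assms(1)] by blast
  have "adj (R ** X) ** (R ** X) = adj X ** (R ** R) ** X"
    using psd_selfadjoint[OF R(1)] by (simp only: adj_mult matrix_mul_assoc)
  then have "R ** X = 0"
    using assms(2) R(2) adj_mult_self_eq_0_iff by metis
  then show ?thesis
    using R(2) by (metis matrix_mul_assoc matrix_zero_mult(2))
qed

text \<open>With \<open>D = B - C\<close>, the hypothesis says that \<open>D (B + C) + (B + C) D = 0\<close>, so that
  \<open>D B D + D C D\<close> has trace 0.\<close>

lemma psd_sqrt_unique:
  assumes "psd B" "psd C" "B ** B = C ** C"
  shows "B = C"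
proof -
  define D where "D = B - C"
  have aD: "adj D = D"
    using assms(1,2) by (simp add: D_def adj_diff psd_selfadjoint)
  have p: "psd (D ** B ** D)" "psd (D ** C ** D)"
    using psd_congruence[of _ D] assms(1,2) aD by auto
  have "D ** (B ** B - C ** C) = 0" using assms(3) by simp
  then have "real_trace (D ** (B ** B - C ** C)) = 0" by simp
  moreover have "real_trace (D ** (B ** B - C ** C)) = real_trace (D ** B ** D) + real_trace (D ** C ** D)"
  proof -
    have "B ** B - C ** C = B ** D + D ** C"
      by (simp add: D_def matrix_ring_simps)
    moreover have "real_trace (D ** (D ** C)) = real_trace (D ** C ** D)"
      by (rule real_trace_commute)
    ultimately show ?thesis
      by (simp add: matrix_add_ldistrib real_trace_add matrix_mul_assoc)
  qed
  ultimately have t: "real_trace (D ** B ** D) = 0" "real_trace (D ** C ** D) = 0"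
    using real_trace_nonneg[OF p(1)] real_trace_nonneg[OF p(2)] by auto
  have "B ** D = 0" "C ** D = 0"
    using psd_trace_eq_0[OF p(1) t(1)] psd_trace_eq_0[OF p(2) t(2)] aD
      conj_eq_0_imp_mult_eq_0[of _ D] assms(1,2) by auto
  moreover have "D ** D = B ** D - C ** D"
    by (simp add: D_def matrix_ring_simps)
  ultimately have "adj D ** D = 0"
    by (simp add: aD)
  then show ?thesis
    by (simp add: adj_mult_self_eq_0_iff D_def)
qed

lemma psd_sqrt_eqI:
  assumes "psd R" "R ** R = A"
  shows "psd_sqrt A = R"
  unfolding psd_sqrt_def
proof (rule the_equality)
  show "psd R \<and> R ** R = A" using assms by simp
  show "B = R" if "psd B \<and> B ** B = A" for B
    using that assms by (metis psd_sqrt_unique)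
qed

lemma
  assumes "psd A"
  shows psd_psd_sqrt: "psd (psd_sqrt A)" and psd_sqrt_mult_self: "psd_sqrt A ** psd_sqrt A = A"
  using ex_psd_sqrt[OF assms] psd_sqrt_eqI by metis+

lemma psd_sqrt_spectral:
  assumes "adj V ** V = mat 1" "\<And>i. d i \<ge> 0"
  shows "psd_sqrt (spectral V d) = spectral V (\<lambda>i. sqrt (d i))"
  by (rule psd_sqrt_eqI) (simp_all add: assms(2) psd_spectral spectral_mult[OF assms(1)])

text \<open>The witness is the Moore-Penrose inverse of \<open>psd_sqrt A\<close>, for which
  \<open>G ** A ** G\<close> is the projection onto the range of \<open>A\<close>.\<close>

lemma psd_pseudo_inverse_sqrt:
  assumes "psd A"
  obtains G where "psd G" "G ** A = psd_sqrt A" "G ** psd_sqrt A = psd_sqrt A ** G"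
    "psd (mat 1 - G ** A ** G)" "psd_sqrt A ** (G ** psd_sqrt A) = psd_sqrt A"
proof -
  obtain V d where V: "adj V ** V = mat 1" "V ** adj V = mat 1" "A = spectral V d" "\<And>i. d i \<ge> 0"
    by (rule psd_spectral_theorem[OF assms]) blast
  \<comment> \<open>Division by zero yields 0, so \<open>G\<close> inverts the root on the range of
    \<open>A\<close> and vanishes on its kernel.\<close>
  define G where "G = spectral V (\<lambda>i. 1 / sqrt (d i))"
  note R = psd_sqrt_spectral[OF V(1,4), folded V(3)]
  have d: "1 / sqrt (d i) * d i = sqrt (d i)" for i
    using V(4)[of i] by (metis mult.commute mult.right_neutral real_div_sqrt times_divide_eq_right)
  have *: "(\<lambda>i. sqrt (d i) * (if d i = 0 then 0 else 1)) = (\<lambda>i. sqrt (d i))" by auto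
  have "0 \<le> 1 - sqrt (d i) * (1 / sqrt (d i))" for i by simp
  then have "psd (mat 1 - G ** A ** G)"
    unfolding G_def V(3) spectral_one[OF V(2), symmetric] spectral_mult[OF V(1)] spectral_diff d
    by (rule psd_spectral)
  then show thesis
    using V(4) d *
    by (intro that[of G]) (simp_all add: G_def R V(3) psd_spectral spectral_mult[OF V(1)] mult.commute)
qed

subsection \<open>Trace norm\<close>

lemma adj_mult_nth: "(adj X ** Y) $ i $ j = cinner (column i X) (column j Y)"
  by (simp add: matrix_matrix_mult_def adj_def cinner_def column_def)

text \<open>Inserting \<open>V ** adj V\<close> and cycling gives the trace in the orthonormal basis
  formed by the columns of the unitary \<open>V\<close>.\<close>

lemma real_trace_eq_sum_columns:
  assumes "V ** adj V = mat 1"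
  shows "real_trace X = (\<Sum>k\<in>UNIV. column k V \<bullet> column k (X ** V))"
proof -
  have "real_trace X = real_trace ((V ** adj V) ** X)" using assms by simp
  also have "\<dots> = real_trace (V ** (adj V ** X))" by (simp only: matrix_mul_assoc)
  also have "\<dots> = real_trace (adj V ** X ** V)" by (rule real_trace_commute)
  also have "\<dots> = real_trace (adj V ** (X ** V))" by (simp only: matrix_mul_assoc)
  also have "\<dots> = (\<Sum>k\<in>UNIV. column k V \<bullet> column k (X ** V))"
    by (simp add: real_trace_def trace_def adj_mult_nth Re_cinner)
  finally show ?thesis .
qed

lemma norm_column: "(norm (column k Y))\<^sup>2 = Re ((adj Y ** Y) $ k $ k)"
  by (simp add: adj_mult_nth Re_cinner dot_square_norm)

text \<open>In an orthonormal eigenbasis of \<open>adj X ** X\<close>, the images of the basis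
  vectors under \<open>X\<close> have the singular values \<open>sqrt (d k)\<close> as lengths.
  Cauchy-Schwarz bounds each diagonal term of the trace by one of them.\<close>

lemma real_trace_le_trace_norm: "real_trace X \<le> trace_norm X"
proof -
  obtain V d where V: "adj V ** V = mat 1" "V ** adj V = mat 1" "adj X ** X = spectral V d" "\<And>i. d i \<ge> 0"
    by (rule psd_spectral_theorem[OF psd_adj_mult[of X]]) blast
  have nV: "norm (column k V) = 1" for k
  proof -
    have "(norm (column k V))\<^sup>2 = 1"
      unfolding norm_column V(1) by (simp add: mat_def)
    then show ?thesis by (simp add: power2_eq_1_iff) (use norm_ge_zero[of "column k V"] in linarith)
  qed
  have "adj (X ** V) ** (X ** V) = adj V ** spectral V d ** V"
    by (simp only: adj_mult matrix_mul_assoc flip: V(3))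
  then have XV: "adj (X ** V) ** (X ** V) = diag_mat d"
    by (simp only: conj_spectral[OF V(1)])
  have nX: "norm (column k (X ** V)) = sqrt (d k)" for k
  proof -
    have "(norm (column k (X ** V)))\<^sup>2 = d k"
      unfolding norm_column XV by (simp add: diag_mat_def)
    then show ?thesis by (metis norm_ge_zero real_sqrt_unique)
  qed
  have "real_trace X \<le> (\<Sum>k\<in>UNIV. norm (column k V) * norm (column k (X ** V)))"
    unfolding real_trace_eq_sum_columns[OF V(2)] by (intro sum_mono norm_cauchy_schwarz)
  also have "\<dots> = trace_norm X"
    by (simp add: nV nX trace_norm_def V(3) psd_sqrt_spectral[OF V(1,4)] real_trace_spectral[OF V(1)])
  finally show ?thesis .
qed

text \<open>The witness \<open>G ** adj X\<close> is the adjoint of the partial isometry in the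
  polar decomposition of \<open>X\<close>; here \<open>U ** adj U\<close> is the support projection
  of \<open>adj X ** X\<close>.\<close>

lemma trace_norm_attained:
  obtains U where "psd (mat 1 - U ** adj U)" "real_trace (U ** X) = trace_norm X"
proof -
  let ?A = "adj X ** X"
  obtain G where G: "psd G" "G ** ?A = psd_sqrt ?A" "psd (mat 1 - G ** ?A ** G)"
    using psd_pseudo_inverse_sqrt[OF psd_adj_mult[of X]] by metis
  have "(G ** adj X) ** adj (G ** adj X) = G ** ?A ** G"
    using psd_selfadjoint[OF G(1)] by (simp add: adj_mult matrix_mul_assoc)
  moreover have "real_trace ((G ** adj X) ** X) = trace_norm X"
    using G(2) by (simp add: trace_norm_def flip: matrix_mul_assoc)
  ultimately show thesis
    using that[of "G ** adj X"] G(3) by simp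
qed

text \<open>The l2 norm of the singular values is at most their l1 norm.\<close>

lemma norm_le_trace_norm: "norm X \<le> trace_norm X"
proof -
  obtain V d where V: "adj V ** V = mat 1" "V ** adj V = mat 1" "adj X ** X = spectral V d" "\<And>i. d i \<ge> 0"
    by (rule psd_spectral_theorem[OF psd_adj_mult[of X]]) blast
  have "(norm X)\<^sup>2 = (\<Sum>i\<in>UNIV. d i)"
    using real_trace_adj_mult_self[of X] by (simp add: V(3) real_trace_spectral[OF V(1)])
  also have "\<dots> = (\<Sum>i\<in>UNIV. (sqrt (d i))\<^sup>2)"
    using V(4) by simp
  finally have "norm X = L2_set (\<lambda>i. sqrt (d i)) UNIV"
    by (simp add: L2_set_def real_sqrt_unique)
  also have "\<dots> \<le> (\<Sum>i\<in>UNIV. sqrt (d i))"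
    using V(4) by (intro L2_set_le_sum) simp
  also have "\<dots> = trace_norm X"
    by (simp add: trace_norm_def V(3) psd_sqrt_spectral[OF V(1,4)] real_trace_spectral[OF V(1)])
  finally show ?thesis .
qed

text \<open>Expanding the nonnegative trace of \<open>adj (mat 1 - U) ** T ** (mat 1 - U)\<close>
  bounds twice the left side by \<open>real_trace T + real_trace (T ** (U ** adj U))\<close>, whose
  last term is at most \<open>real_trace T\<close>.\<close>

lemma real_trace_contraction_le:
  assumes "psd T" "psd (mat 1 - U ** adj U)"
  shows "real_trace (U ** T) \<le> real_trace T"
proof -
  have "0 \<le> real_trace (adj (mat 1 - U) ** T ** (mat 1 - U))"
    by (intro real_trace_nonneg psd_congruence assms)
  also have "\<dots> = real_trace (T ** ((mat 1 - U) ** adj (mat 1 - U)))"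
    by (subst matrix_mul_assoc[symmetric], subst real_trace_commute) (simp only: matrix_mul_assoc)
  also have "\<dots> = real_trace T - real_trace (T ** U) - real_trace (T ** adj U) + real_trace (T ** (U ** adj U))"
    by (simp add: adj_diff matrix_ring_simps real_trace_add real_trace_diff)
  also have "real_trace (T ** adj U) = real_trace (U ** T)"
    using real_trace_adj[of "U ** T"] psd_selfadjoint[OF assms(1)] by (simp add: adj_mult)
  also have "real_trace (T ** U) = real_trace (U ** T)"
    by (rule real_trace_commute)
  finally have "2 * real_trace (U ** T) \<le> real_trace T + real_trace (T ** (U ** adj U))"
    by simp
  moreover have "0 \<le> real_trace (T ** (mat 1 - U ** adj U))"
    by (rule real_trace_mult_nonneg[OF assms])
  ultimately show ?thesis
    by (simp add: matrix_diff_ldistrib real_trace_diff)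
qed

text \<open>For \<open>0 \<le> A \<le> B\<close> the kernel of \<open>B\<close> lies in that of
  \<open>A\<close>: conjugation by \<open>K\<close> squeezes \<open>adj K ** A ** K\<close> between
  0 and 0.\<close>

lemma psd_dominated_mult_eq_0:
  fixes A B K :: "complex ^ 'n ^ 'n"
  assumes "psd A" "psd (B - A)" "B ** K = 0"
  shows "A ** K = 0"
proof -
  have p: "psd (adj K ** A ** K)" by (rule psd_congruence[OF assms(1)])
  have "0 \<le> real_trace (adj K ** (B - A) ** K)"
    by (intro real_trace_nonneg psd_congruence assms)
  also have "\<dots> = real_trace (adj K ** (B ** K)) - real_trace (adj K ** A ** K)"
    by (simp add: matrix_ring_simps real_trace_diff)
  finally have "real_trace (adj K ** A ** K) = 0"
    using real_trace_nonneg[OF p] assms(3) by simp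
  then show ?thesis
    using conj_eq_0_imp_mult_eq_0[OF assms(1)] psd_trace_eq_0[OF p] by blast
qed

text \<open>With \<open>G\<close> the pseudo-inverse of the root of the sum, the left side is the
  sum of the traces of \<open>G ** P j\<close>. Conjugating by \<open>G\<close> takes
  \<open>P j\<close> below the conjugated sum and hence below \<open>mat 1\<close>, so
  \<open>G ** psd_sqrt (P j)\<close> is a contraction.\<close>

lemma real_trace_psd_sqrt_sum_le:
  assumes "finite S" "\<And>j. j \<in> S \<Longrightarrow> psd (P j)"
  shows "real_trace (psd_sqrt (\<Sum>j\<in>S. P j)) \<le> (\<Sum>j\<in>S. real_trace (psd_sqrt (P j)))"
proof -
  let ?A = "\<Sum>j\<in>S. P j"
  obtain G where G: "psd G" "G ** ?A = psd_sqrt ?A" "psd (mat 1 - G ** ?A ** G)"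
    by (rule psd_pseudo_inverse_sqrt[OF psd_sum[OF assms]]) auto
  note aG = psd_selfadjoint[OF G(1)]
  have le: "real_trace (G ** P j) \<le> real_trace (psd_sqrt (P j))" if j: "j \<in> S" for j
  proof -
    let ?R = "psd_sqrt (P j)"
    have R: "psd ?R" "?R ** ?R = P j"
      using psd_psd_sqrt psd_sqrt_mult_self assms(2)[OF j] by auto
    have "psd (?A - P j)"
      using psd_sum[of "S - {j}" P] assms j by (simp add: sum.remove[OF assms(1) j])
    then have "psd (mat 1 - G ** ?A ** G + G ** (?A - P j) ** G)"
      using psd_congruence[of "?A - P j" G] aG by (intro psd_add G) simp
    also have "mat 1 - G ** ?A ** G + G ** (?A - P j) ** G = mat 1 - G ** P j ** G"
      by (simp add: matrix_diff_ldistrib matrix_diff_rdistrib)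
    also have "G ** P j ** G = (G ** ?R) ** adj (G ** ?R)"
      using R aG psd_selfadjoint[OF R(1)] by (metis adj_mult matrix_mul_assoc)
    finally have "real_trace (G ** ?R ** ?R) \<le> real_trace ?R"
      by (rule real_trace_contraction_le[OF R(1)])
    then show ?thesis
      using R(2) by (simp flip: matrix_mul_assoc)
  qed
  have "real_trace (psd_sqrt ?A) = (\<Sum>j\<in>S. real_trace (G ** P j))"
    by (simp only: matrix_sum_mult real_trace_sum flip: G(2))
  also have "\<dots> \<le> (\<Sum>j\<in>S. real_trace (psd_sqrt (P j)))"
    by (intro sum_mono le)
  finally show ?thesis .
qed

text \<open>\<open>P\<close> and \<open>N\<close> are the positive and negative parts of
  \<open>D\<close>, and \<open>E\<close> projects onto the span of the eigenvectors with positive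
  eigenvalue.\<close>

lemma selfadjoint_jordan_decomposition:
  assumes "adj D = D"
  obtains P N E where "psd P" "psd N" "psd E" "psd (mat 1 - E)"
    "D = P - N" "E ** D = P" "D ** E = P"
proof -
  obtain V d where V: "adj V ** V = mat 1" "V ** adj V = mat 1" "D = spectral V d"
    using spectral_theorem[OF assms] by blast
  define E where "E = spectral V (\<lambda>i. if d i > 0 then 1 else 0)"
  define P where "P = spectral V (\<lambda>i. max (d i) 0)"
  define N where "N = spectral V (\<lambda>i. max (- d i) 0)"
  have "psd (mat 1 - E)"
    unfolding E_def spectral_one[OF V(2), symmetric] spectral_diff by (rule psd_spectral) simp
  moreover have "D = P - N"
    unfolding P_def N_def V(3) spectral_diff by (rule arg_cong[of _ _ "spectral V"]) auto
  moreover have "E ** D = P" "D ** E = P"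
    unfolding P_def E_def V(3) spectral_mult[OF V(1)]
    by (rule arg_cong[of _ _ "spectral V"], auto)+
  ultimately show thesis
    by (intro that[of P N E]) (simp_all add: P_def N_def E_def psd_spectral)
qed

subsection \<open>Fidelity and the optimal error for two operators\<close>

text \<open>In this form \<open>A\<close> enters linearly under the root, which makes the
  subadditivity of the trace of the root applicable to sums in the first argument.\<close>

lemma fidelity_eq:
  assumes "psd A" "psd B"
  shows "fidelity A B = real_trace (psd_sqrt (psd_sqrt B ** A ** psd_sqrt B))"
  unfolding fidelity_def trace_norm_def
  by (simp add: adj_mult psd_selfadjoint[OF psd_psd_sqrt] assms matrix_mul_assoc)
    (simp only: psd_sqrt_mult_self[OF assms(1)] flip: matrix_mul_assoc)

lemma fidelity_nonneg: "fidelity A B \<ge> 0"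
  unfolding fidelity_def using norm_le_trace_norm norm_ge_zero order_trans by blast

lemma fidelity_sum_le:
  assumes "finite S" "\<And>j. j \<in> S \<Longrightarrow> psd (B j)" "psd A"
  shows "fidelity (\<Sum>j\<in>S. B j) A \<le> (\<Sum>j\<in>S. fidelity (B j) A)"
proof -
  let ?a = "psd_sqrt A"
  have a: "adj ?a = ?a" by (intro psd_selfadjoint psd_psd_sqrt assms)
  have "fidelity (\<Sum>j\<in>S. B j) A = real_trace (psd_sqrt (\<Sum>j\<in>S. ?a ** B j ** ?a))"
    by (simp add: fidelity_eq psd_sum assms matrix_sum_mult)
  also have "\<dots> \<le> (\<Sum>j\<in>S. real_trace (psd_sqrt (?a ** B j ** ?a)))"
    using psd_congruence[of "B _" ?a] a assms by (intro real_trace_psd_sqrt_sum_le) auto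
  also have "\<dots> = (\<Sum>j\<in>S. fidelity (B j) A)"
    using assms by (simp add: fidelity_eq)
  finally show ?thesis .
qed

text \<open>The left side is the squared Frobenius norm of \<open>psd_sqrt A ** psd_sqrt B\<close>,
  whose trace norm is the fidelity.\<close>

lemma real_trace_mult_le_fidelity_sq:
  assumes "psd A" "psd B"
  shows "real_trace (A ** B) \<le> (fidelity A B)\<^sup>2"
proof -
  let ?a = "psd_sqrt A" and ?b = "psd_sqrt B"
  have sa: "adj ?a = ?a" "adj ?b = ?b" by (intro psd_selfadjoint psd_psd_sqrt assms)+
  have "real_trace (A ** B) = real_trace ((?a ** ?a ** ?b) ** ?b)"
    by (simp only: psd_sqrt_mult_self assms flip: matrix_mul_assoc)
  also have "\<dots> = real_trace (?b ** (?a ** ?a ** ?b))"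
    by (rule real_trace_commute)
  also have "\<dots> = real_trace (adj (?a ** ?b) ** (?a ** ?b))"
    by (simp add: adj_mult sa matrix_mul_assoc)
  also have "\<dots> = (norm (?a ** ?b))\<^sup>2"
    by (rule real_trace_adj_mult_self)
  also have "\<dots> \<le> (fidelity A B)\<^sup>2"
    unfolding fidelity_def by (intro power_mono norm_le_trace_norm norm_ge_zero)
  finally show ?thesis .
qed

section \<open>Tests and the optimal error for two operators\<close>

lemma opt_error_le: "length Es = length As \<Longrightarrow> povm Es \<Longrightarrow> opt_error As \<le> povm_error As Es"
  by (metis opt_error_attained)

lemma opt_error_two_le:
  assumes "psd E" "psd (mat 1 - E)"
  shows "opt_error [A, B] \<le> real_trace (A ** (mat 1 - E)) + real_trace (B ** E)"
proof -
  have "povm [E, mat 1 - E]"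
    using assms by (simp add: povm_def psd_zero)
  from opt_error_le[OF _ this, of "[A, B]"] show ?thesis
    by (simp add: povm_error_def)
qed

text \<open>An optimal POVM \<open>[E, F]\<close> may sum to less than \<open>mat 1\<close>.
  Replacing \<open>F\<close> by the larger \<open>mat 1 - E\<close> cannot increase the error on
  \<open>B\<close>, so a single test \<open>E\<close> describes an optimal measurement.\<close>

lemma opt_error_two_attained:
  assumes "psd B"
  obtains E where "psd E" "psd (mat 1 - E)"
    "real_trace (A ** (mat 1 - E)) + real_trace (B ** E) \<le> opt_error [A, B]"
proof -
  obtain Es where Es: "length Es = length [A, B]" "povm Es" "povm_error [A, B] Es = opt_error [A, B]"
    by (rule opt_error_attained[of "[A, B]"])
  then obtain E F where EF: "Es = [E, F]"
    by (auto simp: length_Suc_conv)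
  have E: "psd E" "psd F" "psd (mat 1 - (E + F))"
    using Es(2) by (simp_all add: EF povm_def)
  have "mat 1 - E = (mat 1 - (E + F)) + F" by simp
  then have "psd (mat 1 - E)" using psd_add[OF E(3,2)] by metis
  moreover have "real_trace (B ** E) \<le> real_trace (B ** (mat 1 - F))"
    using real_trace_mult_nonneg[OF assms E(3)]
    by (simp add: matrix_diff_ldistrib matrix_add_ldistrib real_trace_add real_trace_diff)
  ultimately show thesis
    using that[OF E(1)] Es(3) by (simp add: EF povm_error_def)
qed

lemma opt_error_two_nonneg:
  assumes "psd A" "psd B"
  shows "opt_error [A, B] \<ge> 0"
  using opt_error_two_attained[OF assms(2), of A] real_trace_mult_nonneg assms
  by (smt (verit, best))

text \<open>The quantum Chernoff bound at exponent 1/2. Writing \<open>X, Y\<close> for the square roots and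
  \<open>P, N\<close> for the positive and negative parts of \<open>X - Y\<close>, the projection onto the support of \<open>P\<close>
  has error \<open>Tr X Y - Tr N X - Tr P Y\<close>.\<close>

lemma opt_error_le_real_trace_sqrt_mult:
  assumes "psd A" "psd B"
  shows "opt_error [A, B] \<le> real_trace (psd_sqrt A ** psd_sqrt B)"
proof -
  define X where "X = psd_sqrt A"
  define Y where "Y = psd_sqrt B"
  have XY: "psd X" "psd Y" "A = X ** X" "B = Y ** Y"
    using assms by (simp_all add: X_def Y_def psd_psd_sqrt psd_sqrt_mult_self)
  have "adj (X - Y) = X - Y"
    using XY by (simp add: adj_diff psd_selfadjoint)
  then obtain P N E where E: "psd P" "psd N" "psd E" "psd (mat 1 - E)"
    "X - Y = P - N" "E ** (X - Y) = P" "(X - Y) ** E = P"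
    using selfadjoint_jordan_decomposition by metis
  have "(A - B) ** E = X ** ((X - Y) ** E) + (X - Y) ** Y ** E"
    by (simp add: XY matrix_ring_simps)
  moreover have "real_trace ((X - Y) ** Y ** E) = real_trace (E ** (X - Y) ** Y)"
    by (subst real_trace_commute) (simp only: matrix_mul_assoc)
  ultimately have t: "real_trace ((A - B) ** E) = real_trace (P ** X) + real_trace (P ** Y)"
    by (simp add: E(6,7) real_trace_add real_trace_commute[of X P])
  have "real_trace (X ** (X - Y)) = real_trace (P ** X) - real_trace (N ** X)"
    unfolding E(5) by (subst real_trace_commute) (simp add: matrix_diff_rdistrib real_trace_diff)
  then have "real_trace A - real_trace (X ** Y) = real_trace (P ** X) - real_trace (N ** X)"
    by (simp add: XY(3) matrix_diff_ldistrib real_trace_diff)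
  moreover have "real_trace (N ** X) \<ge> 0" "real_trace (P ** Y) \<ge> 0"
    using E XY by (simp_all add: real_trace_mult_nonneg)
  moreover have "opt_error [A, B] \<le> real_trace A - real_trace ((A - B) ** E)"
    using opt_error_two_le[OF E(3,4), of A B]
    by (simp add: matrix_diff_ldistrib matrix_diff_rdistrib real_trace_diff)
  ultimately show ?thesis
    using t by (simp add: X_def Y_def)
qed

text \<open>The arguments of \<open>fidelity\<close> are exchanged because
  \<open>fidelity_sum_le\<close> splits sums in the first one, where \<open>rest As i\<close> will
  stand.\<close>

lemma opt_error_le_fidelity:
  assumes "psd A" "psd B"
  shows "opt_error [A, B] \<le> fidelity B A"
  using opt_error_le_real_trace_sqrt_mult[OF assms]
    real_trace_le_trace_norm[of "psd_sqrt B ** psd_sqrt A"]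
  by (simp add: fidelity_def real_trace_commute[of "psd_sqrt A"])

text \<open>Splitting \<open>K = k ** k\<close> and cycling makes the trace a product of
  \<open>k ** b ** U\<close> and \<open>a ** k\<close>, with \<open>a\<close>, \<open>b\<close> the
  roots of \<open>A\<close>, \<open>B\<close>. Cauchy-Schwarz gives two norms, and contractivity
  removes \<open>U\<close> from the first.\<close>

lemma real_trace_sandwich_le:
  assumes "psd A" "psd B" "psd K" "psd (mat 1 - U ** adj U)"
  shows "real_trace (U ** psd_sqrt A ** K ** psd_sqrt B)
    \<le> sqrt (real_trace (A ** K)) * sqrt (real_trace (B ** K))"
proof -
  define a where "a = psd_sqrt A"
  define b where "b = psd_sqrt B"
  define k where "k = psd_sqrt K"
  have sq: "a ** a = A" "b ** b = B" "k ** k = K"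
    using assms by (simp_all add: a_def b_def k_def psd_sqrt_mult_self)
  have sa: "adj a = a" "adj b = b" "adj k = k"
    using assms by (simp_all add: a_def b_def k_def psd_psd_sqrt psd_selfadjoint)
  have na: "norm (a ** k) = sqrt (real_trace (A ** K))"
  proof -
    have "(norm (a ** k))\<^sup>2 = real_trace (k ** (a ** a ** k))"
      by (simp add: adj_mult sa matrix_mul_assoc flip: real_trace_adj_mult_self)
    also have "\<dots> = real_trace (a ** a ** (k ** k))"
      by (subst real_trace_commute) (simp only: matrix_mul_assoc)
    finally show ?thesis by (simp add: sq real_sqrt_unique)
  qed
  have nb: "norm (k ** b ** U) \<le> sqrt (real_trace (B ** K))"
  proof -
    \<comment> \<open>Passing to the adjoint brings \<open>U\<close> and \<open>adj U\<close>
      together as \<open>U ** adj U\<close>, the product that the contraction hypothesis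
      bounds.\<close>
    have "(norm (k ** b ** U))\<^sup>2 = real_trace (adj (adj (k ** b ** U)) ** adj (k ** b ** U))"
      by (simp only: real_trace_adj_mult_self norm_adj)
    also have "\<dots> = real_trace (k ** (b ** U ** adj U ** b ** k))"
      by (simp add: adj_mult sa matrix_mul_assoc)
    also have "\<dots> = real_trace (b ** (U ** adj U ** b ** (k ** k)))"
      by (subst real_trace_commute) (simp only: matrix_mul_assoc)
    also have "\<dots> = real_trace ((U ** adj U) ** (b ** K ** b))"
      by (subst real_trace_commute) (simp only: matrix_mul_assoc sq)
    also have "\<dots> \<le> real_trace (b ** K ** b)"
      using real_trace_mult_nonneg[OF assms(4), of "b ** K ** b"] psd_congruence[OF assms(3), of b] sa
      by (simp add: matrix_diff_rdistrib real_trace_diff)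
    also have "\<dots> = real_trace (B ** K)"
      by (subst real_trace_commute) (simp add: matrix_mul_assoc sq)
    finally show ?thesis by (rule real_le_rsqrt)
  qed
  have "real_trace (U ** a ** K ** b) = real_trace ((U ** a ** k) ** (k ** b))"
    by (simp only: matrix_mul_assoc flip: sq(3))
  also have "\<dots> = real_trace ((k ** b ** U) ** (a ** k))"
    by (subst real_trace_commute) (simp only: matrix_mul_assoc)
  also have "\<dots> \<le> norm (k ** b ** U) * norm (a ** k)"
    by (rule real_trace_mult_le)
  also have "\<dots> \<le> sqrt (real_trace (B ** K)) * norm (a ** k)"
    by (intro mult_right_mono nb norm_ge_zero)
  finally show ?thesis
    unfolding na by (simp add: a_def b_def mult.commute)
qed

text \<open>Cauchy-Schwarz in the plane.\<close>

lemma sqrt_mult_add_sq_le: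
  assumes "x1 \<ge> 0" "x2 \<ge> 0" "y1 \<ge> 0" "y2 \<ge> (0::real)"
  shows "(sqrt x1 * sqrt y1 + sqrt x2 * sqrt y2)\<^sup>2 \<le> (x1 + x2) * (y1 + y2)"
proof -
  have "(u * v + s * t)\<^sup>2 \<le> (u\<^sup>2 + s\<^sup>2) * (v\<^sup>2 + t\<^sup>2)" for u v s t :: real
    using zero_le_power2[of "u * t - s * v"] by (simp add: power2_eq_square algebra_simps)
  from this[of "sqrt x1" "sqrt y1" "sqrt x2" "sqrt y2"] show ?thesis
    using assms by simp
qed

lemma fidelity_sq_le_opt_error:
  assumes "psd A" "psd B"
  shows "(fidelity A B)\<^sup>2 \<le> (real_trace A + real_trace B) * opt_error [A, B]"
proof -
  obtain U where U: "psd (mat 1 - U ** adj U)"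
    "real_trace (U ** (psd_sqrt A ** psd_sqrt B)) = fidelity A B"
    using trace_norm_attained[of "psd_sqrt A ** psd_sqrt B"] by (metis fidelity_def)
  obtain E where E: "psd E" "psd (mat 1 - E)"
    "real_trace (A ** (mat 1 - E)) + real_trace (B ** E) \<le> opt_error [A, B]"
    using opt_error_two_attained[OF assms(2)] by blast
  let ?F = "mat 1 - E"
  have n: "real_trace (A ** E) \<ge> 0" "real_trace (A ** ?F) \<ge> 0"
    "real_trace (B ** E) \<ge> 0" "real_trace (B ** ?F) \<ge> 0"
    by (intro real_trace_mult_nonneg assms E)+
  have s: "real_trace (A ** E) + real_trace (A ** ?F) = real_trace A"
    "real_trace (B ** E) + real_trace (B ** ?F) = real_trace B"
    by (simp_all add: matrix_diff_ldistrib real_trace_diff)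
  have "fidelity A B = real_trace (U ** psd_sqrt A ** E ** psd_sqrt B)
      + real_trace (U ** psd_sqrt A ** ?F ** psd_sqrt B)"
    by (simp add: U(2)[symmetric] matrix_ring_simps real_trace_diff)
  also have "\<dots> \<le> sqrt (real_trace (A ** E)) * sqrt (real_trace (B ** E))
      + sqrt (real_trace (B ** ?F)) * sqrt (real_trace (A ** ?F))"
    using real_trace_sandwich_le[OF assms E(1) U(1)] real_trace_sandwich_le[OF assms E(2) U(1)]
    by (simp add: mult.commute)
  finally have "(fidelity A B)\<^sup>2 \<le> (sqrt (real_trace (A ** E)) * sqrt (real_trace (B ** E))
      + sqrt (real_trace (B ** ?F)) * sqrt (real_trace (A ** ?F)))\<^sup>2"
    by (intro power_mono fidelity_nonneg)
  \<comment> \<open>The pairing matters: the first factor collects the successes of the test and is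
    at most \<open>real_trace A + real_trace B\<close>, while the second is exactly its
    error.\<close>
  also have "\<dots> \<le> (real_trace (A ** E) + real_trace (B ** ?F)) * (real_trace (B ** E) + real_trace (A ** ?F))"
    by (intro sqrt_mult_add_sq_le n)
  also have "\<dots> \<le> (real_trace A + real_trace B) * opt_error [A, B]"
    using n s E(3) by (intro mult_mono) auto
  finally show ?thesis .
qed

subsection \<open>The pretty good measurement\<close>

text \<open>With \<open>S = A + B\<close>, the left side is the trace of
  \<open>(A - B) ** E\<close>, the advantage of the test \<open>E\<close> for \<open>A\<close>
  against \<open>B\<close>. The proof completes a square, with \<open>G\<close> in the role of the
  inverse root of \<open>S\<close>.\<close>

lemma real_trace_pretty_good_ge:
  assumes A: "psd A" and S: "psd S" and AS: "psd (S - A)"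
    and G: "psd G" "G ** psd_sqrt S = psd_sqrt S ** G" "psd_sqrt S ** (G ** psd_sqrt S) = psd_sqrt S"
    and E: "psd E" "psd (mat 1 - E)"
  shows "2 * real_trace (A ** E) - real_trace (S ** E) \<le> real_trace (A ** (G ** A ** G))"
proof -
  define R where "R = psd_sqrt S"
  have R: "psd R" "R ** R = S" "G ** R = R ** G" "R ** (G ** R) = R"
    using S G by (simp_all add: R_def psd_psd_sqrt psd_sqrt_mult_self)
  have sa: "adj R = R" "adj G = G" "adj E = E" "adj A = A"
    using R G E A by (simp_all add: psd_selfadjoint)
  \<comment> \<open>The columns of \<open>mat 1 - G ** R\<close> lie in the kernel of
    \<open>S\<close>, hence in that of \<open>A\<close>; so \<open>G ** R\<close> acts as the
    identity next to \<open>A\<close> even for singular \<open>S\<close>.\<close>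
  have "S ** (mat 1 - G ** R) = 0"
    using R(4) by (simp add: matrix_diff_ldistrib flip: R(2) matrix_mul_assoc)
  from psd_dominated_mult_eq_0[OF A AS this] have AGR: "A ** G ** R = A"
    by (simp add: matrix_ring_simps)
  have RGA: "R ** G ** A = A"
    using arg_cong[OF AGR, of adj] by (simp add: adj_mult sa matrix_mul_assoc)
  \<comment> \<open>Conjugating \<open>E\<close> by \<open>R\<close> makes the factors
    \<open>G\<close> cancel in the cross terms, each of which becomes the trace of
    \<open>A ** E\<close>.\<close>
  define H where "H = A - R ** E ** R"
  have aH: "adj H = H"
    by (simp add: H_def adj_diff adj_mult sa matrix_mul_assoc)
  have "0 \<le> real_trace (adj H ** G ** H ** G)"
    by (intro real_trace_mult_nonneg psd_congruence G(1))
  also have "\<dots> = real_trace (A ** G ** A ** G) - real_trace ((A ** G ** R) ** E ** R ** G)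
      - real_trace (R ** E ** (R ** G ** A) ** G) + real_trace (R ** E ** (R ** (G ** R)) ** E ** R ** G)"
    unfolding aH by (simp add: H_def matrix_ring_simps real_trace_add real_trace_diff)
  also have "real_trace ((A ** G ** R) ** E ** R ** G) = real_trace (A ** E)"
  proof -
    have "real_trace (A ** E ** (R ** G)) = real_trace (R ** G ** A ** E)"
      by (subst real_trace_commute) (simp only: matrix_mul_assoc)
    then show ?thesis by (simp add: AGR RGA matrix_mul_assoc)
  qed
  also have "real_trace (R ** E ** (R ** G ** A) ** G) = real_trace (A ** E)"
  proof -
    have "real_trace (R ** (E ** A ** G)) = real_trace (E ** (A ** G ** R))"
      by (subst real_trace_commute) (simp only: matrix_mul_assoc)
    then show ?thesis by (simp add: AGR RGA matrix_mul_assoc real_trace_commute[of E A])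
  qed
  also have "real_trace (R ** E ** (R ** (G ** R)) ** E ** R ** G) = real_trace (R ** E ** R ** E)"
  proof -
    have "real_trace (R ** E ** R ** E ** (R ** G)) = real_trace (R ** (G ** R) ** E ** R ** E)"
      by (subst real_trace_commute) (simp only: matrix_mul_assoc)
    then show ?thesis by (simp only: R(4)) (simp only: matrix_mul_assoc)
  qed
  also have "\<dots> \<le> real_trace (S ** E)"
  proof -
    have "0 \<le> real_trace (adj R ** E ** R ** (mat 1 - E))"
      by (intro real_trace_mult_nonneg psd_congruence E)
    moreover have "real_trace (R ** E ** R) = real_trace (S ** E)"
      by (subst real_trace_commute) (simp add: R(2) matrix_mul_assoc)
    ultimately show ?thesis
      by (simp add: sa matrix_ring_simps real_trace_diff)
  qed
  finally show ?thesis by (simp add: matrix_mul_assoc)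
qed

lemma rest_eq: "i < length As \<Longrightarrow> rest As i = (\<Sum>j<length As. As ! j) - As ! i"
  by (simp add: rest_def sum.remove[of "{..<length As}" i])

lemma psd_rest: "(\<And>j. j < length As \<Longrightarrow> psd (As ! j)) \<Longrightarrow> psd (rest As i)"
  unfolding rest_def by (intro psd_sum) auto

lemma opt_error_le_dich_error:
  assumes psd: "\<And>i. i < length As \<Longrightarrow> psd (As ! i)"
  shows "opt_error As \<le> dich_error As"
proof -
  let ?r = "length As"
  define S where "S = (\<Sum>i<?r. As ! i)"
  have S: "psd S" unfolding S_def by (intro psd_sum psd) auto
  obtain G where G: "psd G" "G ** psd_sqrt S = psd_sqrt S ** G" "psd (mat 1 - G ** S ** G)"
    "psd_sqrt S ** (G ** psd_sqrt S) = psd_sqrt S"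
    using psd_pseudo_inverse_sqrt[OF S] by metis
  \<comment> \<open>The pretty good measurement. Its sum \<open>G ** S ** G\<close> may fall short
    of \<open>mat 1\<close> when \<open>S\<close> is singular, which \<open>povm\<close>
    permits.\<close>
  define M where "M = map (\<lambda>i. G ** As ! i ** G) [0..<?r]"
  have "sum_list M = G ** S ** G"
    by (simp add: M_def S_def interv_sum_list_conv_sum_set_nat atLeast0LessThan matrix_sum_mult)
  then have "povm M"
    using G(3) psd_congruence[OF psd, of _ G] psd_selfadjoint[OF G(1)]
    by (auto simp: povm_def M_def)
  then have "opt_error As \<le> povm_error As M"
    by (intro opt_error_le) (simp_all add: M_def)
  also have "\<dots> \<le> dich_error As"
    unfolding povm_error_def dich_error_def
  proof -
    have "(\<Sum>i<?r. real_trace (As ! i ** (mat 1 - M ! i)))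
        = real_trace S - (\<Sum>i<?r. real_trace (As ! i ** (G ** As ! i ** G)))"
      by (simp add: M_def S_def matrix_diff_ldistrib real_trace_diff sum_subtractf real_trace_sum)
    also have "\<dots> = (\<Sum>i<?r. real_trace (As ! i) - real_trace (As ! i ** (G ** As ! i ** G)))"
      by (simp add: S_def sum_subtractf real_trace_sum)
    also have "\<dots> \<le> (\<Sum>i<?r. opt_error [As ! i, rest As i])"
    proof (rule sum_mono)
      fix i assume "i \<in> {..<?r}"
      then have i: "i < ?r" by simp
      have rest: "rest As i = S - As ! i" "psd (rest As i)"
        unfolding S_def by (rule rest_eq[OF i], rule psd_rest[OF psd])
      obtain E where E: "psd E" "psd (mat 1 - E)"
        "real_trace (As ! i ** (mat 1 - E)) + real_trace (rest As i ** E) \<le> opt_error [As ! i, rest As i]"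
        using opt_error_two_attained[OF rest(2)] by blast
      \<comment> \<open>As \<open>S = As ! i + rest As i\<close>, subtracting the left side from
        \<open>real_trace (As ! i)\<close> leaves exactly the error of the test \<open>E\<close> in
        the dichotomy.\<close>
      have "2 * real_trace (As ! i ** E) - real_trace (S ** E) \<le> real_trace (As ! i ** (G ** As ! i ** G))"
        by (rule real_trace_pretty_good_ge) (use psd[OF i] S rest G E in auto)
      then show "real_trace (As ! i) - real_trace (As ! i ** (G ** As ! i ** G)) \<le> opt_error [As ! i, rest As i]"
        using E(3) by (simp add: rest(1) matrix_diff_ldistrib matrix_diff_rdistrib real_trace_diff)
    qed
    finally show "(\<Sum>i<?r. real_trace (As ! i ** (mat 1 - M ! i))) \<le> (\<Sum>i<?r. opt_error [As ! i, rest As i])" .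
  qed
  finally show ?thesis .
qed

subsection \<open>Rank one\<close>

text \<open>The row space is spanned by one vector \<open>w\<close>, so the entries factor as
  \<open>c i * w $ j\<close> and squaring multiplies by the trace, which is real by
  self-adjointness.\<close>

lemma psd_rank_one_square:
  assumes "psd A" "rank A = 1"
  shows "A ** A = real_trace A *\<^sub>R A" "real_trace A > 0"
proof -
  obtain B where B: "B \<subseteq> rows A" "vec.independent B" "rows A \<subseteq> vec.span B" "card B = vec.dim (rows A)"
    using vec.basis_exists by blast
  then obtain w where w: "B = {w}"
    using assms(2) by (auto simp: row_rank_def_gen card_1_singleton_iff)
  have "\<exists>c. row i A = c *s w" for i
    using B(3) by (auto simp: w rows_def vec.span_singleton)
  then obtain c where c: "\<And>i. row i A = c i *s w" by metis
  have A: "A $ i $ j = c i * w $ j" for i j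
    using arg_cong[OF c[of i], of "\<lambda>v. v $ j"] by (simp add: row_def)
  have "A $ i $ i = complex_of_real (Re (A $ i $ i))" for i
    using arg_cong[OF psd_selfadjoint[OF assms(1)], of "\<lambda>X. X $ i $ i"]
    by (simp add: adj_def complex_eq_iff)
  then have t: "trace A = complex_of_real (real_trace A)"
    by (simp add: trace_def real_trace_def)
  have "(A ** A) $ i $ j = trace A * A $ i $ j" for i j
    by (simp add: matrix_matrix_mult_def trace_def A sum_distrib_left mult.commute mult.left_commute)
  then show "A ** A = real_trace A *\<^sub>R A"
    by (simp only: vec_eq_iff t) (simp add: scaleR_conv_of_real[of "real_trace A" "_ $ _ $ _"])
  have "w \<noteq> 0"
    using B(2) w vec.dependent_zero by blast
  then have "A \<noteq> 0"
    using B(1) w by (auto simp: rows_def row_def vec_eq_iff) metis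
  then show "real_trace A > 0"
    using psd_trace_eq_0[OF assms(1)] real_trace_nonneg[OF assms(1)] by fastforce
qed

lemma scaleR_matrix_mult: "(c *\<^sub>R A) ** B = c *\<^sub>R (A ** B)" "A ** (c *\<^sub>R B) = c *\<^sub>R (A ** B)"
  for A B :: "complex ^ 'n ^ 'n"
  by (simp_all add: scalar_matrix_assoc matrix_scalar_ac)

text \<open>Normalised by its trace, \<open>A\<close> is a projection that fixes \<open>A\<close>;
  used as the test, it leaves only the error on \<open>B\<close>.\<close>

lemma rank_one_opt_error_le:
  assumes "psd A" "rank A = 1"
  shows "opt_error [A, B] \<le> real_trace (B ** A) / real_trace A"
proof -
  let ?p = "real_trace A"
  note AA = psd_rank_one_square[OF assms]
  define E where "E = (1 / ?p) *\<^sub>R A"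
  have aA: "adj A = A" by (rule psd_selfadjoint[OF assms(1)])
  have aE: "adj E = E"
    using aA by (simp add: E_def adj_def vec_eq_iff)
  have EE: "E ** E = E" and AE: "A ** E = A"
    using AA(2) by (simp_all add: E_def scaleR_matrix_mult AA(1))
  have "psd E" using psd_square[OF aE] EE by simp
  moreover have "psd (mat 1 - E)"
    using psd_square[of "mat 1 - E"] aE EE by (simp add: adj_diff matrix_ring_simps)
  ultimately have "opt_error [A, B] \<le> real_trace (A ** (mat 1 - E)) + real_trace (B ** E)"
    by (rule opt_error_two_le)
  also have "\<dots> = real_trace (B ** A) / ?p"
    by (simp add: matrix_diff_ldistrib AE real_trace_diff) (simp add: E_def scaleR_matrix_mult real_trace_scaleR)
  finally show ?thesis .
qed

section \<open>Sums over ordered pairs and the assembly of the bounds\<close>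

lemma sum_off_diag: "(\<Sum>(i, j)\<in>off_diag r. f i j) = (\<Sum>i<r. \<Sum>j\<in>{..<r} - {i}. f i j)"
proof -
  have "off_diag r = (SIGMA i:{..<r}. {..<r} - {i})"
    by (auto simp: off_diag_def)
  then show ?thesis by (simp add: sum.Sigma)
qed

lemma sum_off_diag_swap: "(\<Sum>(i, j)\<in>off_diag r. f j i) = (\<Sum>(i, j)\<in>off_diag r. f i j)"
  by (rule sum.reindex_bij_witness[of _ prod.swap prod.swap]) (auto simp: off_diag_def)

theorem theorem5p5:
  fixes As :: "(complex ^ 'n ^ 'n) list" and r :: nat
    and p :: "nat \<Rightarrow> real" and A0 :: "complex ^ 'n ^ 'n"
  assumes r: "r = length As" and r_pos: "r \<ge> 1"
    and psd: "\<And>i. i < r \<Longrightarrow> psd (As ! i)"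
    and p: "\<And>i. i < r \<Longrightarrow> p i = real_trace (As ! i)"
    and A0: "A0 = (\<Sum>i<r. As ! i)"
  shows
    "opt_error As \<le> dich_error As
     \<and> dich_error As \<le> (\<Sum>(i, j)\<in>off_diag r. fidelity (As ! i) (As ! j))
     \<and> (\<Sum>(i, j)\<in>off_diag r. fidelity (As ! i) (As ! j))
         \<le> (\<Sum>(i, j)\<in>off_diag r. sqrt (p i + p j) * sqrt (opt_error [As ! i, As ! j]))
     \<and> ((\<forall>i<r. rank (As ! i) = 1) \<longrightarrow>
          opt_error As \<le> dich_error As
        \<and> dich_error As
            \<le> real_trace A0 * (\<Sum>(i, j)\<in>off_diag r. 1 / (p i * p j) * (fidelity (As ! i) (As ! j))\<^sup>2)
        \<and> real_trace A0 * (\<Sum>(i, j)\<in>off_diag r. 1 / (p i * p j) * (fidelity (As ! i) (As ! j))\<^sup>2)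
            \<le> real_trace A0 * (\<Sum>(i, j)\<in>off_diag r. (p i + p j) / (p i * p j) * opt_error [As ! i, As ! j])
        \<and> dich_error As
            \<le> real_trace A0 / (MIN i\<in>{..<r}. real_trace (As ! i))
              * (\<Sum>(i, j)\<in>off_diag r. opt_error [As ! i, As ! j]))"
proof -
  have opt_le: "opt_error As \<le> dich_error As"
    by (rule opt_error_le_dich_error) (use psd r in auto)
  have rest: "rest As i = (\<Sum>j\<in>{..<r} - {i}. As ! j)" for i
    by (simp add: rest_def r)
  have "dich_error As \<le> (\<Sum>i<r. \<Sum>j\<in>{..<r} - {i}. fidelity (As ! j) (As ! i))"
    unfolding dich_error_def r[symmetric]
  proof (rule sum_mono)
    fix i assume "i \<in> {..<r}"
    then have i: "i < r" by simp
    have "opt_error [As ! i, rest As i] \<le> fidelity (rest As i) (As ! i)"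
      using psd_rest[of As i] psd i r by (intro opt_error_le_fidelity) auto
    also have "\<dots> \<le> (\<Sum>j\<in>{..<r} - {i}. fidelity (As ! j) (As ! i))"
      unfolding rest using psd i by (intro fidelity_sum_le) auto
    finally show "opt_error [As ! i, rest As i] \<le> (\<Sum>j\<in>{..<r} - {i}. fidelity (As ! j) (As ! i))" .
  qed
  then have dich_le: "dich_error As \<le> (\<Sum>(i, j)\<in>off_diag r. fidelity (As ! i) (As ! j))"
    by (simp add: sum_off_diag_swap[of "\<lambda>i j. fidelity (As ! i) (As ! j)"] flip: sum_off_diag)
  have fid_sq: "(fidelity (As ! i) (As ! j))\<^sup>2 \<le> (p i + p j) * opt_error [As ! i, As ! j]"
    if "i < r" "j < r" for i j
    using fidelity_sq_le_opt_error[of "As ! i" "As ! j"] psd p that by simp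
  have "fidelity (As ! i) (As ! j) \<le> sqrt (p i + p j) * sqrt (opt_error [As ! i, As ! j])"
    if "i < r" "j < r" for i j
    using real_le_rsqrt[OF fid_sq[OF that]] by (simp add: real_sqrt_mult)
  then have fid_le: "(\<Sum>(i, j)\<in>off_diag r. fidelity (As ! i) (As ! j))
      \<le> (\<Sum>(i, j)\<in>off_diag r. sqrt (p i + p j) * sqrt (opt_error [As ! i, As ! j]))"
    by (intro sum_mono) (auto simp: off_diag_def)
  have rank1: "dich_error As
        \<le> real_trace A0 * (\<Sum>(i, j)\<in>off_diag r. 1 / (p i * p j) * (fidelity (As ! i) (As ! j))\<^sup>2)"
    "real_trace A0 * (\<Sum>(i, j)\<in>off_diag r. 1 / (p i * p j) * (fidelity (As ! i) (As ! j))\<^sup>2)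
        \<le> real_trace A0 * (\<Sum>(i, j)\<in>off_diag r. (p i + p j) / (p i * p j) * opt_error [As ! i, As ! j])"
    "dich_error As
        \<le> real_trace A0 / (MIN i\<in>{..<r}. real_trace (As ! i))
          * (\<Sum>(i, j)\<in>off_diag r. opt_error [As ! i, As ! j])"
    if rank: "\<forall>i<r. rank (As ! i) = 1"
  proof -
    have p_pos: "p i > 0" if "i < r" for i
      using psd_rank_one_square(2)[OF psd] rank p that by simp
    have A0_sum: "real_trace A0 = (\<Sum>i<r. p i)"
      by (simp add: A0 real_trace_sum p)
    have p_le: "p i \<le> real_trace A0" if "i < r" for i
      unfolding A0_sum using that p_pos by (intro member_le_sum) (auto intro: less_imp_le)
    have A0_pos: "real_trace A0 > 0"
      using p_pos[of 0] p_le[of 0] r_pos by simp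
    \<comment> \<open>Distinct indices contribute separately to the trace of \<open>A0\<close>; for
      \<open>i = j\<close> the bound could fail.\<close>
    have p_add_le: "p i + p j \<le> real_trace A0" if "i < r" "j < r" "i \<noteq> j" for i j
    proof -
      have "(\<Sum>k\<in>{i, j}. p k) \<le> (\<Sum>k<r. p k)"
        using that p_pos by (intro sum_mono2) (auto intro: less_imp_le)
      then show ?thesis using that by (simp add: A0_sum)
    qed
    have "dich_error As \<le> (\<Sum>i<r. \<Sum>j\<in>{..<r} - {i}. (fidelity (As ! j) (As ! i))\<^sup>2 / p i)"
      unfolding dich_error_def r[symmetric]
    proof (rule sum_mono)
      fix i assume "i \<in> {..<r}"
      then have i: "i < r" by simp
      have "opt_error [As ! i, rest As i] \<le> real_trace (rest As i ** As ! i) / p i"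
        using rank_one_opt_error_le[OF psd[OF i]] rank p i by simp
      also have "\<dots> = (\<Sum>j\<in>{..<r} - {i}. real_trace (As ! j ** As ! i) / p i)"
        by (simp add: rest matrix_sum_mult real_trace_sum sum_divide_distrib)
      also have "\<dots> \<le> (\<Sum>j\<in>{..<r} - {i}. (fidelity (As ! j) (As ! i))\<^sup>2 / p i)"
        using psd i p_pos[OF i]
        by (intro sum_mono divide_right_mono real_trace_mult_le_fidelity_sq) auto
      finally show "opt_error [As ! i, rest As i] \<le> (\<Sum>j\<in>{..<r} - {i}. (fidelity (As ! j) (As ! i))\<^sup>2 / p i)" .
    qed
    \<comment> \<open>Common source of both rank-one bounds, obtained below by estimating its
      summands in two ways.\<close>
    then have D: "dich_error As \<le> (\<Sum>(i, j)\<in>off_diag r. (fidelity (As ! i) (As ! j))\<^sup>2 / p j)"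
      by (simp add: sum_off_diag_swap[of "\<lambda>i j. (fidelity (As ! i) (As ! j))\<^sup>2 / p j"] flip: sum_off_diag)
    have "(fidelity (As ! i) (As ! j))\<^sup>2 / p j
        \<le> real_trace A0 * (1 / (p i * p j) * (fidelity (As ! i) (As ! j))\<^sup>2)" if "i < r" "j < r" for i j
    proof -
      \<comment> \<open>The weight \<open>1 / p j\<close> is written as
        \<open>p i / (p i * p j)\<close>, and \<open>p i\<close> is enlarged to
        \<open>real_trace A0\<close>.\<close>
      have "p i / (p i * p j) * (fidelity (As ! i) (As ! j))\<^sup>2
          \<le> real_trace A0 / (p i * p j) * (fidelity (As ! i) (As ! j))\<^sup>2"
        using p_le p_pos that by (intro mult_right_mono divide_right_mono) (auto simp: less_imp_le)
      then show ?thesis using p_pos[OF that(1)] by simp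
    qed
    then have "(\<Sum>(i, j)\<in>off_diag r. (fidelity (As ! i) (As ! j))\<^sup>2 / p j)
        \<le> real_trace A0 * (\<Sum>(i, j)\<in>off_diag r. 1 / (p i * p j) * (fidelity (As ! i) (As ! j))\<^sup>2)"
      unfolding sum_distrib_left by (intro sum_mono) (auto simp: off_diag_def)
    with D show "dich_error As
        \<le> real_trace A0 * (\<Sum>(i, j)\<in>off_diag r. 1 / (p i * p j) * (fidelity (As ! i) (As ! j))\<^sup>2)"
      by (rule order_trans)
    have "1 / (p i * p j) * (fidelity (As ! i) (As ! j))\<^sup>2
        \<le> (p i + p j) / (p i * p j) * opt_error [As ! i, As ! j]" if "i < r" "j < r" for i j
      using divide_right_mono[OF fid_sq[OF that], of "p i * p j"] p_pos that by (simp add: less_imp_le)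
    then show "real_trace A0 * (\<Sum>(i, j)\<in>off_diag r. 1 / (p i * p j) * (fidelity (As ! i) (As ! j))\<^sup>2)
        \<le> real_trace A0 * (\<Sum>(i, j)\<in>off_diag r. (p i + p j) / (p i * p j) * opt_error [As ! i, As ! j])"
      using A0_pos by (intro mult_left_mono sum_mono) (auto simp: off_diag_def)
    let ?m = "MIN i\<in>{..<r}. real_trace (As ! i)"
    have m_le: "?m \<le> p j" if "j < r" for j
      using that by (simp add: p)
    have m_pos: "?m > 0"
      using r_pos p_pos p by (subst Min_gr_iff) (auto simp: lessThan_empty_iff bot_nat_def)
    have "(fidelity (As ! i) (As ! j))\<^sup>2 / p j \<le> real_trace A0 / ?m * opt_error [As ! i, As ! j]"
      if "i < r" "j < r" "i \<noteq> j" for i j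
    proof -
      have nn: "opt_error [As ! i, As ! j] \<ge> 0"
        using psd that by (intro opt_error_two_nonneg)
      have "(fidelity (As ! i) (As ! j))\<^sup>2 / p j \<le> (p i + p j) * opt_error [As ! i, As ! j] / p j"
        using fid_sq p_pos that by (intro divide_right_mono) (auto simp: less_imp_le)
      also have "\<dots> = (p i + p j) / p j * opt_error [As ! i, As ! j]" by simp
      \<comment> \<open>The numerator grows to the whole trace because the indices are distinct, and
        the denominator shrinks to the smallest trace.\<close>
      also have "\<dots> \<le> real_trace A0 / ?m * opt_error [As ! i, As ! j]"
        using nn A0_pos m_pos m_le[OF that(2)] p_add_le[OF that]
        by (intro mult_right_mono frac_le) auto
      finally show ?thesis .
    qed
    then have "(\<Sum>(i, j)\<in>off_diag r. (fidelity (As ! i) (As ! j))\<^sup>2 / p j)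
        \<le> real_trace A0 / ?m * (\<Sum>(i, j)\<in>off_diag r. opt_error [As ! i, As ! j])"
      unfolding sum_distrib_left by (intro sum_mono) (auto simp: off_diag_def)
    with D show "dich_error As \<le> real_trace A0 / ?m * (\<Sum>(i, j)\<in>off_diag r. opt_error [As ! i, As ! j])"
      by (rule order_trans)
  qed
  show ?thesis
    using opt_le dich_le fid_le rank1 by blast
qed

end
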